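(* Let $d\in\{2,3\}$ and let $\Omega=\mathbb T^{d-1}\times(0,1)$ be the unit periodic channel in $\mathbb R^d$. There exists $C>0$ depending on $d$ only such that the following is true. Let $\bar u=Ae_1$ be a constant shear flow for some $A>0$, and let $u^\nu$ be a Leray–Hopf solution to the Navier–Stokes equation $(\mathrm{NSE}_\nu)$ in $\Omega$ with kinematic viscosity $\nu>0$. Put $\mathsf{Re}=A/\nu$. For any $T>0$, $$\|u^\nu(T)-\bar u\|_{L^2(\Omega)}^2+\frac{\nu}{2}\|\nabla u^\nu\|_{L^2((0,T)\times\Omega)}^2\le 4\|u^\nu(0)-\bar u\|_{L^2(\Omega)}^2+CA^3T+CA^2\,\mathsf{Re}^{-1}\log(2+\mathsf{Re}).$$
   Context: $\mathbb T=[0,1]_{\mathrm{per}}$ is the unit periodic domain and $e_1$ is the first coordinate vector. The equation $(\mathrm{NSE}_\nu)$, with velocity $u^\nu:(0,T)\times\Omega\to\mathbb R^d$ and pressure $P^\nu:(0,T)\times\Omega\to\mathbb R$, is $$\partial_t u^\nu+u^\nu\cdot\nabla u^\nu+\nabla P^\nu=\nu\Delta u^\nu,\qquad \operatorname{div}u^\nu=0\quad\text{in }(0,T)\times\Omega,\qquad u^\nu=0\ \text{for } x_d=0\text{ and }x_d=1.$$ A Leray–Hopf solution is a weak solution to $(\mathrm{NSE}_\nu)$ (with initial value $u^\nu(0)\in L^2(\Omega)$) which in addition verifies the energy inequality $\frac12\frac{d}{dt}\|u^\nu\|_{L^2(\Omega)}^2\le-\nu\|\nabla u^\nu\|_{L^2(\Omega)}^2$;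 integrated from time $0$, this gives $\frac12\|u^\nu(T)\|_{L^2(\Omega)}^2+\nu\|\nabla u^\nu\|_{L^2((0,T)\times\Omega)}^2\le\frac12\|u^\nu(0)\|_{L^2(\Omega)}^2$. *)

theory Defs
  imports "HOL-Analysis.Analysis"
begin

text \<open>
  The channel is periodic with period 1 in every coordinate except the wall-normal coordinate
  \<open>w\<close>, which ranges over the unit interval. A function on it is represented by a function on the
  whole coordinate space that is periodic in the tangential coordinates, and integrals over the
  channel are integrals over one period cell. Values outside the strip
  \<open>{x. 0 < x $ w \<and> x $ w < 1}\<close> are irrelevant.
\<close>

definition cell :: "(real^'n) set" where
  "cell = {x. \<forall>i. 0 < x $ i \<and> x $ i < 1}"

definition tangentially_periodic :: "'n::finite \<Rightarrow> (real^'n \<Rightarrow> 'b) \<Rightarrow> bool" where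
  "tangentially_periodic w f \<longleftrightarrow> (\<forall>i x. i \<noteq> w \<longrightarrow> f (x + axis i 1) = f x)"

definition L2_on :: "'a::euclidean_space set \<Rightarrow> ('a \<Rightarrow> 'b::euclidean_space) \<Rightarrow> bool" where
  "L2_on S f \<longleftrightarrow> set_borel_measurable lborel S f \<and> set_integrable lborel S (\<lambda>x. (norm (f x))\<^sup>2)"

text \<open>For matrix-valued functions, \<open>norm\<close> is the Frobenius norm and \<open>\<bullet>\<close> the Frobenius product.\<close>

definition L2_norm :: "'a::euclidean_space set \<Rightarrow> ('a \<Rightarrow> 'b::euclidean_space) \<Rightarrow> real" where
  "L2_norm S f = sqrt (LINT x:S|lborel. (norm (f x))\<^sup>2)"

definition dir_deriv :: "'a \<Rightarrow> ('a::real_normed_vector \<Rightarrow> 'b::real_normed_vector) \<Rightarrow> 'a \<Rightarrow> 'b" where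
  "dir_deriv v f x = frechet_derivative f (at x) v"

text \<open>Infinite differentiability: all iterated directional derivatives are Frechet differentiable.\<close>

definition smooth :: "('a::euclidean_space \<Rightarrow> 'b::euclidean_space) \<Rightarrow> bool" where
  "smooth f \<longleftrightarrow> (\<forall>vs x. fold dir_deriv vs f differentiable (at x))"

text \<open>The support is compact in the open channel: tangentially this is automatic by periodicity.\<close>

definition space_test :: "'n::finite \<Rightarrow> (real^'n \<Rightarrow> 'b::euclidean_space) \<Rightarrow> bool" where
  "space_test w \<phi> \<longleftrightarrow> smooth \<phi> \<and> tangentially_periodic w \<phi> \<and>
     (\<exists>\<epsilon>>0. \<forall>x. \<phi> x \<noteq> 0 \<longrightarrow> \<epsilon> \<le> x $ w \<and> x $ w \<le> 1 - \<epsilon>)"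

text \<open>
  Smooth functions on \<open>[0,T)\<close> with compact support, given by a smooth extension to the whole
  line; they need not vanish at time 0.
\<close>

definition time_test :: "real \<Rightarrow> (real \<Rightarrow> real) \<Rightarrow> bool" where
  "time_test T \<theta> \<longleftrightarrow> smooth \<theta> \<and> (\<exists>\<epsilon>>0. \<forall>t. \<theta> t \<noteq> 0 \<longrightarrow> t \<le> T - \<epsilon>)"

text \<open>Solenoidal fields with compact support in \<open>[0,T)\<close> times the channel, in the same sense.\<close>

definition solenoidal_test :: "'n::finite \<Rightarrow> real \<Rightarrow> (real \<times> (real^'n) \<Rightarrow> real^'n) \<Rightarrow> bool" where
  "solenoidal_test w T \<phi> \<longleftrightarrow> smooth \<phi> \<and> (\<forall>t. tangentially_periodic w (\<lambda>x. \<phi> (t, x))) \<and>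
     (\<exists>\<epsilon>>0. \<forall>t x. \<phi> (t, x) \<noteq> 0 \<longrightarrow> t \<le> T - \<epsilon> \<and> \<epsilon> \<le> x $ w \<and> x $ w \<le> 1 - \<epsilon>) \<and>
     (\<forall>t x. trace (jacobian (\<lambda>y. \<phi> (t, y)) (at x)) = 0)"

text \<open>Convention: \<open>G x $ i $ j\<close> is the derivative of the \<open>i\<close>-th component in direction \<open>j\<close>.\<close>

definition has_weak_gradient ::
    "'n::finite \<Rightarrow> (real^'n \<Rightarrow> real^'n) \<Rightarrow> (real^'n \<Rightarrow> real^'n^'n) \<Rightarrow> bool" where
  "has_weak_gradient w f G \<longleftrightarrow>
     (\<forall>\<psi> i j. space_test w \<psi> \<longrightarrow>
        (LINT x:cell|lborel. f x $ i * dir_deriv (axis j 1) \<psi> x) =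
        - (LINT x:cell|lborel. G x $ i $ j * \<psi> x))"

text \<open>
  \<open>f\<close> lies in the closure of the test fields in the Sobolev space of order one, which is
  how the no-slip condition at \<open>x $ w = 0\<close> and \<open>x $ w = 1\<close> is imposed; \<open>G\<close> is its gradient.
\<close>

definition H10 :: "'n::finite \<Rightarrow> (real^'n \<Rightarrow> real^'n) \<Rightarrow> (real^'n \<Rightarrow> real^'n^'n) \<Rightarrow> bool" where
  "H10 w f G \<longleftrightarrow> L2_on cell f \<and> L2_on cell G \<and> has_weak_gradient w f G \<and>
     (\<exists>\<phi> :: nat \<Rightarrow> real^'n \<Rightarrow> real^'n. (\<forall>k. space_test w (\<phi> k)) \<and>
        (\<lambda>k. L2_norm cell (\<lambda>x. \<phi> k x - f x)) \<longlonglongrightarrow> 0 \<and>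
        (\<lambda>k. L2_norm cell (\<lambda>x. jacobian (\<phi> k) (at x) - G x)) \<longlonglongrightarrow> 0)"

definition weakly_continuous :: "real \<Rightarrow> (real \<Rightarrow> real^'n \<Rightarrow> real^'n) \<Rightarrow> bool" where
  "weakly_continuous T u \<longleftrightarrow> (\<forall>t\<in>{0..T}. L2_on cell (u t)) \<and>
     (\<forall>v. L2_on cell v \<longrightarrow> continuous_on {0..T} (\<lambda>t. LINT x:cell|lborel. u t x \<bullet> v x))"

text \<open>
  Weak solutions of the Navier--Stokes equation with viscosity \<open>\<nu>\<close> on the time interval
  \<open>(0,T)\<close>, with initial value \<open>u 0\<close> and velocity gradient \<open>G\<close>. Testing with solenoidal fields
  eliminates the pressure. Weak continuity gives a meaning to \<open>u t\<close> for every \<open>t\<close> in \<open>[0,T]\<close>.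
  The argument \<open>G\<close> is determined by \<open>u\<close> almost everywhere in the channel.
\<close>

definition weak_solution ::
    "'n::finite \<Rightarrow> real \<Rightarrow> real \<Rightarrow> (real \<Rightarrow> real^'n \<Rightarrow> real^'n) \<Rightarrow> (real \<Rightarrow> real^'n \<Rightarrow> real^'n^'n) \<Rightarrow> bool" where
  "weak_solution w \<nu> T u G \<longleftrightarrow>
     (\<forall>t. tangentially_periodic w (u t) \<and> tangentially_periodic w (G t)) \<and>
     weakly_continuous T u \<and>
     L2_on ({0<..<T} \<times> cell) (\<lambda>(t, x). u t x) \<and>
     L2_on ({0<..<T} \<times> cell) (\<lambda>(t, x). G t x) \<and>
     (\<exists>M. AE t in lborel. t \<in> {0<..<T} \<longrightarrow> L2_norm cell (u t) \<le> M) \<and>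
     (AE t in lborel. t \<in> {0<..<T} \<longrightarrow> H10 w (u t) (G t)) \<and>
     (AE t in lborel. t \<in> {0<..<T} \<longrightarrow> (AE x in lborel. x \<in> cell \<longrightarrow> trace (G t x) = 0)) \<and>
     (\<forall>\<phi>. solenoidal_test w T \<phi> \<longrightarrow>
        (LINT z:({0<..<T} \<times> cell)|lborel. case z of (t, x) \<Rightarrow>
            u t x \<bullet> dir_deriv (1, 0) \<phi> (t, x)
          + u t x \<bullet> (jacobian (\<lambda>y. \<phi> (t, y)) (at x) *v u t x)
          - \<nu> * (G t x \<bullet> jacobian (\<lambda>y. \<phi> (t, y)) (at x)))
        + (LINT x:cell|lborel. u 0 x \<bullet> \<phi> (0, x)) = 0)"

text \<open>
  The energy inequality \<open>(1/2) d/dt \<parallel>u\<parallel>\<^sup>2 \<le> -\<nu> \<parallel>\<nabla>u\<parallel>\<^sup>2\<close> in the sense of distributions on \<open>[0,T)\<close>.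
  Test functions may be nonzero at time 0, whence the term with \<open>u 0\<close>, so that the
  inequality can be integrated from time 0.
\<close>

definition energy_inequality ::
    "real \<Rightarrow> real \<Rightarrow> (real \<Rightarrow> real^'n \<Rightarrow> real^'n) \<Rightarrow> (real \<Rightarrow> real^'n \<Rightarrow> real^'n^'n) \<Rightarrow> bool" where
  "energy_inequality \<nu> T u G \<longleftrightarrow>
     (\<forall>\<theta>. time_test T \<theta> \<and> (\<forall>t. 0 \<le> \<theta> t) \<longrightarrow>
        - (1/2) * (LINT t:{0<..<T}|lborel. deriv \<theta> t * (L2_norm cell (u t))\<^sup>2)
          - (1/2) * \<theta> 0 * (L2_norm cell (u 0))\<^sup>2
        \<le> - \<nu> * (LINT t:{0<..<T}|lborel. \<theta> t * (L2_norm cell (G t))\<^sup>2))"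

definition leray_hopf ::
    "'n::finite \<Rightarrow> real \<Rightarrow> real \<Rightarrow> (real \<Rightarrow> real^'n \<Rightarrow> real^'n) \<Rightarrow> (real \<Rightarrow> real^'n \<Rightarrow> real^'n^'n) \<Rightarrow> bool" where
  "leray_hopf w \<nu> T u G \<longleftrightarrow> weak_solution w \<nu> T u G \<and> energy_inequality \<nu> T u G"

end

(*
  The energy inequality reduces the claim to bounding A times the momentum loss
  int u_k(0) - int u_k(T). Up to wall layers of width delta = c nu / A, whose contribution is
  O(A^2 delta) plus half of |u - ubar|^2 at times 0 and T, the momentum is tested with a
  cut-off chi(x_w) e_k. The convective flux is then bounded by delta^{-1} int |u|^2 over the layers,
  hence by delta |grad u|^2 because u vanishes at the walls, and for small c the viscosity absorbs
  A times this; the viscous flux is absorbed up to nu A^2 T / delta = A^3 T / c.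
  If delta > 1/4, the momentum is bounded trivially, at the cost of A^2 < 4 c A^2 / Re.
*)
theory Submission
  imports Defs
begin

section \<open>Smooth functions and a smooth step\<close>

text \<open>\<open>ubar\<close> violates the no-slip condition, so neither the energy inequality nor
  the wall inequality can be applied to \<open>u - ubar\<close>; both are applied to
  \<open>u\<close>. The shear enters by expanding a square: the cell has measure one, so the term
  \<open>A\<^sup>2\<close> is the same at both times and cancels. Inside the layers the flux is
  estimated by \<open>u\<close>, which is small there, but the momentum is compared with
  \<open>A\<close>, because it is the deviation that can be reabsorbed. The shear direction is
  tangential, so a cut-off in the wall-normal coordinate yields a solenoidal field and the pressure
  stays out. The energy inequality supplies dissipation with factor \<open>2 * \<nu>\<close>, of
  which the two fluxes take \<open>\<nu> / 2\<close> each. The layer cost is of order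
  \<open>\<nu> * A = A\<^sup>2 * inverse Re\<close>; a lower bound for the logarithm brings it into
  the stated form. Energy and momentum are known in weak form only. Their values at \<open>T\<close>
  come from cut-offs in time, where weak continuity of \<open>u\<close> suffices: momentum is linear
  in \<open>u\<close>, and energy is needed from below only.\<close>

lemma smooth_coinduct:
  assumes "P f"
    and "\<And>f. P f \<Longrightarrow> (\<forall>x. f differentiable (at x)) \<and> (\<forall>v. P (dir_deriv v f))"
  shows "smooth f"
proof -
  have "P (fold dir_deriv vs f)" for vs
    using assms(1) by (induction vs arbitrary: f) (auto dest: assms(2))
  then show ?thesis using assms(2) by (auto simp: smooth_def)
qed

lemma smooth_differentiable: "smooth f \<Longrightarrow> f differentiable (at x)"
  unfolding smooth_def by (metis fold_simps(1))

lemma smooth_dir_deriv: "smooth f \<Longrightarrow> smooth (dir_deriv v f)"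
  unfolding smooth_def by (metis fold_simps(2))

lemma smooth_continuous: "smooth f \<Longrightarrow> continuous_on S f"
  by (meson smooth_differentiable continuous_at_imp_continuous_on differentiable_imp_continuous_within)

lemma smooth_has_derivative:
  "smooth f \<Longrightarrow> (f has_derivative (\<lambda>v. dir_deriv v f x)) (at x)"
  unfolding dir_deriv_def using smooth_differentiable frechet_derivative_works
  by metis

lemma dir_deriv_eq: "(f has_derivative F) (at x) \<Longrightarrow> dir_deriv v f x = F v"
  unfolding dir_deriv_def using frechet_derivative_at by metis

text \<open>The product rule sends one product to a sum of two, so a family of products is invariant
  under differentiation only up to sums. With this closure, \<open>smooth_coinduct_add\<close> asks
  for derivatives of the generators alone.\<close>

inductive add_closure :: "(('a \<Rightarrow> 'b::plus) \<Rightarrow> bool) \<Rightarrow> ('a \<Rightarrow> 'b) \<Rightarrow> bool" for P where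
  base: "P f \<Longrightarrow> add_closure P f"
| add: "add_closure P f \<Longrightarrow> add_closure P g \<Longrightarrow> add_closure P (\<lambda>x. f x + g x)"

lemma smooth_coinduct_add:
  assumes "P f"
    and "\<And>f. P f \<Longrightarrow> (\<forall>x. f differentiable (at x)) \<and> (\<forall>v. add_closure P (dir_deriv v f))"
  shows "smooth f"
proof (rule smooth_coinduct[where P = "add_closure P"])
  show "add_closure P f" using assms(1) by (rule add_closure.base)
  show "(\<forall>x. f differentiable (at x)) \<and> (\<forall>v. add_closure P (dir_deriv v f))"
    if "add_closure P f" for f
    using that
  proof induction
    case (add f g)
    have "dir_deriv v (\<lambda>x. f x + g x) = (\<lambda>x. dir_deriv v f x + dir_deriv v g x)" for v
    proof
      fix x
      have "(f has_derivative frechet_derivative f (at x)) (at x)"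
           "(g has_derivative frechet_derivative g (at x)) (at x)"
        using add frechet_derivative_works by blast+
      from has_derivative_add[OF this]
      show "dir_deriv v (\<lambda>x. f x + g x) x = dir_deriv v f x + dir_deriv v g x"
        using dir_deriv_eq unfolding dir_deriv_def by blast
    qed
    then show ?case using add by (auto intro: add_closure.add)
  qed (use assms(2) in blast)
qed

text \<open>All cut-offs below are affine reparametrisations of one step, which is why this
  composition rule is singled out. The derivative along \<open>v\<close> is the derivative of
  \<open>f\<close> along \<open>L v\<close> composed with the same affine map, so the family is
  invariant.\<close>

lemma smooth_affine:
  fixes f :: "'b::euclidean_space \<Rightarrow> 'c::euclidean_space" and L :: "'a::euclidean_space \<Rightarrow> 'b"
  assumes "smooth f" "bounded_linear L"
  shows "smooth (\<lambda>x. f (L x + a))"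
proof (rule smooth_coinduct[where P = "\<lambda>g. \<exists>f. smooth f \<and> g = (\<lambda>x. f (L x + a))"])
  show "\<exists>f'. smooth f' \<and> (\<lambda>x. f (L x + a)) = (\<lambda>x. f' (L x + a))" using assms(1) by blast
  show "(\<forall>x. g differentiable (at x)) \<and> (\<forall>v. \<exists>f. smooth f \<and> dir_deriv v g = (\<lambda>x. f (L x + a)))"
    if ex: "\<exists>f. smooth f \<and> g = (\<lambda>x. f (L x + a))" for g :: "'a \<Rightarrow> 'c"
  proof -
    obtain f where f: "smooth f" and g: "g = (\<lambda>x. f (L x + a))" using ex by blast
    have D: "(g has_derivative (\<lambda>v. dir_deriv (L v) f (L x + a))) (at x)" for x
    proof -
      have "((\<lambda>x. L x + a) has_derivative L) (at x)"
        using bounded_linear_imp_has_derivative[OF assms(2)] by (auto intro!: derivative_eq_intros)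
      from has_derivative_compose[OF this smooth_has_derivative[OF f]] show ?thesis by (simp add: g)
    qed
    have "dir_deriv v g = (\<lambda>x. dir_deriv (L v) f (L x + a))" for v
      using dir_deriv_eq[OF D] by blast
    then show ?thesis using D smooth_dir_deriv[OF f] by (metis differentiable_def)
  qed
qed

lemma smooth_bounded_linear_image:
  fixes f :: "'a::euclidean_space \<Rightarrow> 'b::euclidean_space" and L :: "'b \<Rightarrow> 'c::euclidean_space"
  assumes "smooth f" "bounded_linear L"
  shows "smooth (\<lambda>x. L (f x))"
proof (rule smooth_coinduct[where P = "\<lambda>g. \<exists>f. smooth f \<and> g = (\<lambda>x. L (f x))"])
  show "\<exists>f'. smooth f' \<and> (\<lambda>x. L (f x)) = (\<lambda>x. L (f' x))" using assms(1) by blast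
  show "(\<forall>x. g differentiable (at x)) \<and> (\<forall>v. \<exists>f. smooth f \<and> dir_deriv v g = (\<lambda>x. L (f x)))"
    if ex: "\<exists>f. smooth f \<and> g = (\<lambda>x. L (f x))" for g :: "'a \<Rightarrow> 'c"
  proof -
    obtain f where f: "smooth f" and g: "g = (\<lambda>x. L (f x))" using ex by blast
    have D: "(g has_derivative (\<lambda>v. L (dir_deriv v f x))) (at x)" for x
      unfolding g using bounded_linear.has_derivative[OF assms(2) smooth_has_derivative[OF f]] .
    have "dir_deriv v g = (\<lambda>x. L (dir_deriv v f x))" for v
      using dir_deriv_eq[OF D] by blast
    then show ?thesis using D smooth_dir_deriv[OF f] by (metis differentiable_def)
  qed
qed

lemma smooth_const [simp]: "smooth (\<lambda>x. c)"
proof (rule smooth_coinduct[where P = "\<lambda>f. \<exists>c. f = (\<lambda>x. c)"])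
  show "(\<forall>x. f differentiable (at x)) \<and> (\<forall>v. \<exists>c. dir_deriv v f = (\<lambda>x. c))"
    if ex: "\<exists>c. f = (\<lambda>x. c)" for f :: "'a \<Rightarrow> 'b"
  proof -
    obtain c where "f = (\<lambda>x. c)" using ex by blast
    then have D: "(f has_derivative (\<lambda>v. 0)) (at x)" for x by simp
    then have "dir_deriv v f = (\<lambda>x. 0)" for v using dir_deriv_eq by blast
    then show ?thesis using D by (metis differentiable_def)
  qed
qed auto

lemma dir_deriv_scaleR:
  fixes f :: "'a::euclidean_space \<Rightarrow> real"
  assumes "smooth f" "smooth g"
  shows "dir_deriv v (\<lambda>x. f x *\<^sub>R g x) x = f x *\<^sub>R dir_deriv v g x + dir_deriv v f x *\<^sub>R g x"
  using dir_deriv_eq[OF has_derivative_scaleR[OF assms[THEN smooth_has_derivative]]] .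

lemma smooth_scaleR:
  fixes f :: "'a::euclidean_space \<Rightarrow> real" and g :: "'a \<Rightarrow> 'b::euclidean_space"
  assumes "smooth f" "smooth g" shows "smooth (\<lambda>x. f x *\<^sub>R g x)"
proof (rule smooth_coinduct_add
    [where P = "\<lambda>h. \<exists>(f :: 'a \<Rightarrow> real) g. smooth f \<and> smooth g \<and> h = (\<lambda>x. f x *\<^sub>R g x)"])
  show "(\<forall>x. h differentiable (at x)) \<and>
      (\<forall>v. add_closure (\<lambda>h. \<exists>(f :: 'a \<Rightarrow> real) g. smooth f \<and> smooth g \<and> h = (\<lambda>x. f x *\<^sub>R g x))
        (dir_deriv v h))"
    if ex: "\<exists>(f :: 'a \<Rightarrow> real) g. smooth f \<and> smooth g \<and> h = (\<lambda>x. f x *\<^sub>R g x)" for h :: "'a \<Rightarrow> 'b"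
  proof -
    obtain f :: "'a \<Rightarrow> real" and g :: "'a \<Rightarrow> 'b"
      where fg: "smooth f" "smooth g" and h: "h = (\<lambda>x. f x *\<^sub>R g x)" using ex by blast
    have "h differentiable (at x)" for x
      unfolding h using has_derivative_scaleR[OF fg[THEN smooth_has_derivative]]
      by (rule differentiableI)
    moreover have "dir_deriv v h = (\<lambda>x. f x *\<^sub>R dir_deriv v g x + dir_deriv v f x *\<^sub>R g x)" for v
      unfolding h using dir_deriv_scaleR[OF fg] by blast
    moreover have "add_closure (\<lambda>h. \<exists>(f :: 'a \<Rightarrow> real) g. smooth f \<and> smooth g \<and> h = (\<lambda>x. f x *\<^sub>R g x))
        (\<lambda>x. f x *\<^sub>R dir_deriv v g x + dir_deriv v f x *\<^sub>R g x)" for v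
    proof (rule add_closure.add; rule add_closure.base)
      show "\<exists>f' g'. smooth f' \<and> smooth g' \<and> (\<lambda>x. f x *\<^sub>R dir_deriv v g x) = (\<lambda>x. (f' x :: real) *\<^sub>R g' x)"
        using fg smooth_dir_deriv by (intro exI[of _ f] exI[of _ "dir_deriv v g"]) auto
      show "\<exists>f' g'. smooth f' \<and> smooth g' \<and> (\<lambda>x. dir_deriv v f x *\<^sub>R g x) = (\<lambda>x. (f' x :: real) *\<^sub>R g' x)"
        using fg smooth_dir_deriv by (intro exI[of _ "dir_deriv v f"] exI[of _ g]) auto
    qed
    ultimately show ?thesis by simp
  qed
qed (use assms in blast)

lemma smooth_mult:
  fixes f g :: "'a::euclidean_space \<Rightarrow> real"
  assumes "smooth f" "smooth g" shows "smooth (\<lambda>x. f x * g x)"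
  using smooth_scaleR[OF assms] by simp

lemma smooth_add:
  assumes "smooth f" "smooth g" shows "smooth (\<lambda>x. f x + g x)"
proof (rule smooth_coinduct[where P = "\<lambda>h. \<exists>f g. smooth f \<and> smooth g \<and> h = (\<lambda>x. f x + g x)"])
  show "(\<forall>x. h differentiable (at x)) \<and>
      (\<forall>v. \<exists>f g. smooth f \<and> smooth g \<and> dir_deriv v h = (\<lambda>x. f x + g x))"
    if ex: "\<exists>f g. smooth f \<and> smooth g \<and> h = (\<lambda>x. f x + g x)" for h :: "'a \<Rightarrow> 'b"
  proof -
    obtain f g where fg: "smooth f" "smooth g" and h: "h = (\<lambda>x. f x + g x)" using ex by blast
    note D = has_derivative_add[OF fg[THEN smooth_has_derivative], folded h]
    have "dir_deriv v h = (\<lambda>x. dir_deriv v f x + dir_deriv v g x)" for v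
      using dir_deriv_eq[OF D] by blast
    then show ?thesis using D fg smooth_dir_deriv by (metis differentiable_def)
  qed
qed (use assms in blast)

lemma smooth_diff:
  assumes "smooth f" "smooth g" shows "smooth (\<lambda>x. f x - g x)"
  using smooth_add[OF assms(1) smooth_scaleR[OF smooth_const[of "-1"] assms(2)]] by simp

lemma dir_deriv_real:
  fixes f :: "real \<Rightarrow> real"
  assumes "(f has_real_derivative f') (at x)"
  shows "dir_deriv v f x = f' * v"
  using dir_deriv_eq assms unfolding has_field_derivative_def by fastforce

lemma differentiable_real:
  "(f has_real_derivative f') (at x) \<Longrightarrow> f differentiable (at x)"
  unfolding has_field_derivative_def by (rule differentiableI)

text \<open>The first directional derivatives of \<open>F\<close> are multiples of the smooth
  \<open>f\<close>, so one step of coinduction leads from \<open>F\<close> into the smooth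
  functions. This gives smoothness of a step that is known only through its slope.\<close>

lemma smooth_antiderivative:
  fixes F f :: "real \<Rightarrow> real"
  assumes "smooth f" "\<And>x. (F has_real_derivative f x) (at x)"
  shows "smooth F"
proof (rule smooth_coinduct[where P = "\<lambda>g. g = F \<or> smooth g"])
  have "dir_deriv v F = (\<lambda>x. f x * v)" for v
    using dir_deriv_real[OF assms(2)] by blast
  then show "(\<forall>x. g differentiable (at x)) \<and> (\<forall>v. dir_deriv v g = F \<or> smooth (dir_deriv v g))"
    if "g = F \<or> smooth g" for g
    using that smooth_mult[OF assms(1) smooth_const] smooth_dir_deriv smooth_differentiable
      differentiable_real[OF assms(2)] by metis
qed simp

lemma smooth_exp: "smooth (exp :: real \<Rightarrow> real)"
proof (rule smooth_coinduct[where P = "\<lambda>g. \<exists>c. g = (\<lambda>x. c * exp x)"])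
  show "\<exists>c::real. exp = (\<lambda>x. c * exp x)" by (rule exI[of _ 1]) simp
  show "(\<forall>x. g differentiable (at x)) \<and> (\<forall>v. \<exists>c. dir_deriv v g = (\<lambda>x. c * exp x))"
    if ex: "\<exists>c. g = (\<lambda>x. c * exp x)" for g :: "real \<Rightarrow> real"
  proof -
    obtain c where g: "g = (\<lambda>x. c * exp x)" using ex by blast
    have D: "(g has_real_derivative c * exp x) (at x)" for x
      unfolding g by (auto intro!: derivative_eq_intros)
    have "dir_deriv v g = (\<lambda>x. (c * v) * exp x)" for v
      using dir_deriv_real[OF D] by (auto simp: mult_ac)
    then show ?thesis using differentiable_real[OF D] by blast
  qed
qed

text \<open>The iterated derivatives of \<open>exp (- 1 / x)\<close>, extended by 0, are linear combinations of these.\<close>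

definition flat :: "nat \<Rightarrow> real \<Rightarrow> real" where
  "flat n x = (if x \<le> 0 then 0 else inverse x ^ n * exp (- inverse x))"

text \<open>Away from 0 this is the product rule. At 0 both one-sided limits of the difference
  quotient vanish, on the right because \<open>exp (- inverse x)\<close> beats every power of
  \<open>inverse x\<close>.\<close>

lemma flat_has_derivative:
  "(flat n has_real_derivative flat (n + 2) x - real n * flat (n + 1) x) (at x)"
proof -
  consider "x < 0" | "x = 0" | "x > 0" by linarith
  then show ?thesis
  proof cases
    case 1
    have "((\<lambda>x. 0) has_real_derivative flat (n + 2) x - real n * flat (n + 1) x) (at x)"
      using 1 by (simp add: flat_def)
    then show ?thesis
      by (rule has_field_derivative_transform_within_open[where S = "{..<0}"])
        (use 1 in \<open>auto simp: flat_def\<close>)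
  next
    case 3
    have I: "(inverse has_real_derivative - (inverse x * inverse x)) (at x)"
      using 3 by (auto intro!: derivative_eq_intros)
    \<comment> \<open>For \<open>n = 0\<close> the exponent \<open>n - 1\<close> is truncated to 0,
      but then the factor \<open>real n\<close> removes the term.\<close>
    have "((\<lambda>x. inverse x ^ n) has_real_derivative
        real n * (inverse x ^ (n - 1) * - (inverse x * inverse x))) (at x)"
      using DERIV_power[OF I, of n] by (simp add: mult_ac)
    moreover have "((\<lambda>x. exp (- inverse x)) has_real_derivative
        exp (- inverse x) * (inverse x * inverse x)) (at x)"
      using 3 by (auto intro!: derivative_eq_intros)
    ultimately have "((\<lambda>x. inverse x ^ n * exp (- inverse x)) has_real_derivative
        flat (n + 2) x - real n * flat (n + 1) x) (at x)"
      using 3 by (intro DERIV_cong[OF DERIV_mult]) (assumption | cases n; simp add: flat_def algebra_simps)+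
    then show ?thesis
      by (rule has_field_derivative_transform_within_open[where S = "{0<..}"])
        (use 3 in \<open>auto simp: flat_def\<close>)
  next
    case 2
    have "((\<lambda>x::real. inverse x ^ (n + 1) / exp (inverse x)) \<longlongrightarrow> 0) (at_right 0)"
      using filterlim_compose[OF tendsto_power_div_exp_0 filterlim_inverse_at_top_right] .
    then have "(flat (n + 1) \<longlongrightarrow> 0) (at_right 0)"
      by (rule Lim_transform_eventually)
        (auto simp: flat_def eventually_at_filter exp_minus field_simps)
    moreover have "(flat (n + 1) \<longlongrightarrow> 0) (at_left 0)"
      by (rule Lim_transform_eventually[OF tendsto_const])
        (auto simp: flat_def eventually_at_filter)
    ultimately have "(flat (n + 1) \<longlongrightarrow> 0) (at 0)"
      by (simp add: filterlim_split_at)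
    \<comment> \<open>Since \<open>flat n 0 = 0\<close>, dividing by \<open>h\<close> only raises
      the power: the quotient is \<open>flat (n + 1) h\<close>.\<close>
    then have "((\<lambda>h. (flat n (0 + h) - flat n 0) / h) \<longlongrightarrow> 0) (at 0)"
      by (rule Lim_transform_eventually)
        (auto simp: flat_def eventually_at_filter field_simps)
    then show ?thesis unfolding DERIV_def 2 by (simp add: flat_def)
  qed
qed

lemma smooth_flat: "smooth (flat n)"
proof (rule smooth_coinduct_add[where P = "\<lambda>f. \<exists>c n. f = (\<lambda>x. c * flat n x)"])
  show "\<exists>c m. flat n = (\<lambda>x. c * flat m x)" by (intro exI[of _ 1] exI[of _ n]) simp
  show "(\<forall>x. f differentiable (at x)) \<and>
      (\<forall>v. add_closure (\<lambda>f. \<exists>c n. f = (\<lambda>x. c * flat n x)) (dir_deriv v f))"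
    if ex: "\<exists>c n. f = (\<lambda>x. c * flat n x)" for f
  proof -
    obtain c n where f: "f = (\<lambda>x. c * flat n x)" using ex by blast
    have D: "(f has_real_derivative c * (flat (n + 2) x - real n * flat (n + 1) x)) (at x)" for x
      unfolding f by (intro DERIV_cmult flat_has_derivative)
    have "dir_deriv v f = (\<lambda>x. (c * v) * flat (n + 2) x + (- c * v * real n) * flat (n + 1) x)" for v
      by (rule ext) (simp add: dir_deriv_real[OF D] algebra_simps)
    moreover have "add_closure (\<lambda>f. \<exists>c n. f = (\<lambda>x. c * flat n x))
        (\<lambda>x. (c * v) * flat (n + 2) x + (- c * v * real n) * flat (n + 1) x)" for v
      by (rule add_closure.add; rule add_closure.base; rule exI, rule exI, rule refl)
    ultimately show ?thesis using differentiable_real[OF D] by simp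
  qed
qed

text \<open>Time and wall cut-offs are rescalings of one profile \<open>H\<close> with slope
  \<open>b\<close>. The slope bound \<open>K\<close> enters the estimates, and fixing the profile
  before any data of the flow makes the final constant independent of \<open>A\<close>,
  \<open>\<nu>\<close> and \<open>T\<close>.\<close>

locale smooth_step =
  fixes H b :: "real \<Rightarrow> real" and K :: real
  assumes smooth: "smooth H"
    and continuous_bump: "continuous_on UNIV b"
    and has_derivative: "\<And>x. (H has_real_derivative b x) (at x)"
    and eq_0: "\<And>x. x \<le> 0 \<Longrightarrow> H x = 0"
    and eq_1: "\<And>x. 1 \<le> x \<Longrightarrow> H x = 1"
    and nonneg: "\<And>x. 0 \<le> H x"
    and le_1: "\<And>x. H x \<le> 1"
    and bump_nonneg: "\<And>x. 0 \<le> b x"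
    and bump_le: "\<And>x. b x \<le> K"
    and bump_eq_0: "\<And>x. x \<le> 0 \<or> 1 \<le> x \<Longrightarrow> b x = 0"

text \<open>The product of a flat function and its reflection is positive exactly on the open unit
  interval. Its antiderivative is therefore constant on either side, and the total increment
  \<open>N\<close> normalises it.\<close>

lemma smooth_step_exists: "\<exists>H b K. smooth_step H b K"
proof -
  define p where "p x = flat 0 x * flat 0 (1 - x)" for x
  have "smooth (\<lambda>x. flat 0 ((- x) + 1))"
    by (intro smooth_affine smooth_flat) (simp add: bounded_linear_minus)
  then have p: "smooth p" unfolding p_def
    by (intro smooth_mult smooth_flat) (simp add: add.commute)
  have pc: "continuous_on S p" for S using smooth_continuous[OF p] .
  have "\<exists>F. \<forall>x. -\<infinity> < ereal x \<longrightarrow> ereal x < \<infinity> \<longrightarrow> (F has_vector_derivative p x) (at x)"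
    by (rule einterval_antiderivative)
      (use pc[of UNIV] in \<open>auto simp: continuous_on_eq_continuous_at\<close>)
  then obtain F where F: "(F has_real_derivative p x) (at x)" for x
    by (auto simp: has_real_derivative_iff_has_vector_derivative)
  have p0: "p x = 0" if "x \<le> 0 \<or> 1 \<le> x" for x using that by (auto simp: p_def flat_def)
  have pnn: "0 \<le> p x" for x by (auto simp: p_def flat_def)
  have pos: "0 < p x" if "0 < x" "x < 1" for x using that by (auto simp: p_def flat_def)
  have Fc: "continuous_on S F" for S
    using DERIV_isCont[OF F] by (blast intro: continuous_at_imp_continuous_on)
  have "F 0 < F 1"
    by (rule DERIV_pos_imp_increasing_open[OF zero_less_one _ Fc]) (use F pos in blast)
  define N where "N = F 1 - F 0"
  then have N: "N > 0" using \<open>F 0 < F 1\<close> by simp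
  have mono: "F x \<le> F y" if "x \<le> y" for x y
    using that DERIV_nonneg_imp_nondecreasing[of x y F] F pnn by blast
  have left: "F x = F 0" if "x \<le> 0" for x
  proof (cases "x = 0")
    case False
    then have "F 0 = F x"
      using that F p0 by (intro DERIV_isconst_end[OF _ Fc]) (auto, metis less_imp_le)
    then show ?thesis by simp
  qed simp
  have right: "F x = F 1" if "1 \<le> x" for x
  proof (cases "x = 1")
    case False
    then show ?thesis
      using that F p0 by (intro DERIV_isconst_end[OF _ Fc]) (auto, metis less_imp_le)
  qed simp
  define H where "H x = (F x - F 0) / N" for x
  have D: "(H has_real_derivative p x / N) (at x)" for x
    unfolding H_def using F N by (auto intro!: derivative_eq_intros)
  have b: "smooth (\<lambda>x. p x / N)"
    using smooth_mult[OF p smooth_const[of "1 / N"]] by simp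
  \<comment> \<open>The bound comes from compactness of the unit interval; outside it the slope
    vanishes.\<close>
  obtain K where K: "\<And>x. x \<in> {0..1} \<Longrightarrow> p x / N \<le> K"
  proof -
    have "compact ((\<lambda>x. p x / N) ` {0..1})"
      by (intro compact_continuous_image smooth_continuous b) auto
    then have "bdd_above ((\<lambda>x. p x / N) ` {0..1})"
      by (intro bounded_imp_bdd_above compact_imp_bounded)
    then obtain M where "\<forall>x\<in>{0..1}. p x / N \<le> M" by (auto simp: bdd_above_def)
    then show ?thesis using that by blast
  qed
  have K0: "0 \<le> K" using K[of 0] p0[of 0] by simp
  have "smooth_step H (\<lambda>x. p x / N) K"
  proof
    show "smooth H" using smooth_antiderivative[OF b D] .
    show "continuous_on UNIV (\<lambda>x. p x / N)" using smooth_continuous[OF b] .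
    show "H x = 0" if "x \<le> 0" for x using left[OF that] by (simp add: H_def)
    show "H x = 1" if "1 \<le> x" for x using right[OF that] N by (simp add: H_def N_def)
    show "0 \<le> H x" for x using mono[of 0 x] left[of x] N by (cases "x \<le> 0") (auto simp: H_def)
    show "H x \<le> 1" for x using mono[of x 1] right[of x] N by (cases "1 \<le> x") (auto simp: H_def N_def)
    show "p x / N \<le> K" for x using K[of x] p0[of x] K0 by (cases "x \<in> {0..1}") auto
  qed (use D pnn p0 N in auto)
  then show ?thesis by blast
qed

section \<open>Square integrable fields\<close>

lemma L2_on_measurable: "L2_on S f \<Longrightarrow> set_borel_measurable lborel S f"
  and L2_on_integrable: "L2_on S f \<Longrightarrow> set_integrable lborel S (\<lambda>x. (norm (f x))\<^sup>2)"
  by (simp_all add: L2_on_def)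

lemma L2_norm_nonneg: "0 \<le> L2_norm S f"
  by (simp add: L2_norm_def set_lebesgue_integral_def)

lemma L2_norm_power2: "(L2_norm S f)\<^sup>2 = (LINT x:S|lborel. (norm (f x))\<^sup>2)"
  by (simp add: L2_norm_def set_lebesgue_integral_def)

text \<open>Measurability is available for the fields multiplied by the indicator of
  \<open>S\<close>. The indicator is idempotent, so multiplying the cut-off fields gives the cut-off
  product.\<close>

lemma set_borel_measurable_mult_inner:
  fixes f g :: "'a::euclidean_space \<Rightarrow> 'b::euclidean_space"
  assumes "set_borel_measurable lborel S f" "set_borel_measurable lborel S g"
    and "b \<in> borel_measurable borel"
  shows "set_borel_measurable lborel S (\<lambda>x. b x * (f x \<bullet> g x))"
proof -
  have "(\<lambda>x. b x * ((indicator S x *\<^sub>R f x) \<bullet> (indicator S x *\<^sub>R g x))) \<in> borel_measurable lborel"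
    using assms unfolding set_borel_measurable_def by measurable
  also have "(\<lambda>x. b x * ((indicator S x *\<^sub>R f x) \<bullet> (indicator S x *\<^sub>R g x))) =
      (\<lambda>x. indicator S x *\<^sub>R (b x * (f x \<bullet> g x)))"
    by (rule ext) (simp add: indicator_def)
  finally show ?thesis by (simp only: set_borel_measurable_def)
qed

lemma L2_mult_inner_integrable:
  fixes f g :: "'a::euclidean_space \<Rightarrow> 'b::euclidean_space"
  assumes "L2_on S f" "L2_on S g" "b \<in> borel_measurable borel" "\<And>x. x \<in> S \<Longrightarrow> \<bar>b x\<bar> \<le> B"
  shows "set_integrable lborel S (\<lambda>x. b x * (f x \<bullet> g x))"
proof (rule set_integrable_bound)
  show "set_integrable lborel S (\<lambda>x. \<bar>B\<bar> * ((norm (f x))\<^sup>2 + (norm (g x))\<^sup>2))"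
    using assms by (intro set_integrable_mult_right set_integral_add L2_on_integrable) auto
  show "set_borel_measurable lborel S (\<lambda>x. b x * (f x \<bullet> g x))"
    using assms by (intro set_borel_measurable_mult_inner L2_on_measurable)
  have "norm (b x * (f x \<bullet> g x)) \<le> norm (\<bar>B\<bar> * ((norm (f x))\<^sup>2 + (norm (g x))\<^sup>2))" if "x \<in> S" for x
  proof -
    have "\<bar>f x \<bullet> g x\<bar> \<le> norm (f x) * norm (g x)" by (rule Cauchy_Schwarz_ineq2)
    also have "\<dots> \<le> (norm (f x))\<^sup>2 + (norm (g x))\<^sup>2"
      using sum_squares_bound[of "norm (f x)" "norm (g x)"]
        mult_nonneg_nonneg[OF norm_ge_zero[of "f x"] norm_ge_zero[of "g x"]] by linarith
    finally show ?thesis using assms(4)[OF that]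
      by (auto simp: abs_mult intro!: mult_mono)
  qed
  then show "AE x in lborel. x \<in> S \<longrightarrow>
      norm (b x * (f x \<bullet> g x)) \<le> norm (\<bar>B\<bar> * ((norm (f x))\<^sup>2 + (norm (g x))\<^sup>2))"
    by simp
qed

lemma L2_on_bounded:
  assumes "L2_on S f" "set_borel_measurable lborel S g" "\<And>x. x \<in> S \<Longrightarrow> norm (g x) \<le> C * norm (f x)"
  shows "L2_on S g"
  unfolding L2_on_def
proof
  show "set_integrable lborel S (\<lambda>x. (norm (g x))\<^sup>2)"
  proof (rule set_integrable_bound)
    show "set_integrable lborel S (\<lambda>x. C\<^sup>2 * (norm (f x))\<^sup>2)"
      using L2_on_integrable[OF assms(1)] by simp
    show "set_borel_measurable lborel S (\<lambda>x. (norm (g x))\<^sup>2)"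
      using set_borel_measurable_mult_inner[OF assms(2,2), of "\<lambda>_. 1"]
      by (simp add: power2_norm_eq_inner)
    show "AE x in lborel. x \<in> S \<longrightarrow> norm ((norm (g x))\<^sup>2) \<le> norm (C\<^sup>2 * (norm (f x))\<^sup>2)"
      using power_mono[OF assms(3) norm_ge_zero, of _ 2] by (auto simp: power_mult_distrib)
  qed
qed (rule assms)

lemma L2_on_bounded_linear:
  fixes f :: "'a::euclidean_space \<Rightarrow> 'b::euclidean_space" and L :: "'b \<Rightarrow> 'c::euclidean_space"
  assumes "L2_on S f" "bounded_linear L"
  shows "L2_on S (\<lambda>x. L (f x))"
proof -
  obtain K where K: "\<And>x. norm (L x) \<le> norm x * K" using bounded_linear.bounded[OF assms(2)] by blast
  have "L \<in> borel_measurable borel"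
    by (intro borel_measurable_continuous_onI linear_continuous_on assms)
  with L2_on_measurable[OF assms(1)] have "(\<lambda>x. L (indicator S x *\<^sub>R f x)) \<in> borel_measurable lborel"
    unfolding set_borel_measurable_def by measurable
  then have "set_borel_measurable lborel S (\<lambda>x. L (f x))"
    by (simp add: set_borel_measurable_def linear_simps[OF assms(2)])
  then show ?thesis
    by (rule L2_on_bounded[OF assms(1), of _ K]) (use K in \<open>simp add: mult.commute\<close>)
qed

lemma L2_on_add:
  assumes "L2_on S f" "L2_on S g" shows "L2_on S (\<lambda>x. f x + g x)"
  unfolding L2_on_def
proof
  have "(\<lambda>x. indicator S x *\<^sub>R f x + indicator S x *\<^sub>R g x) \<in> borel_measurable lborel"
    using assms[THEN L2_on_measurable] unfolding set_borel_measurable_def by measurable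
  then show m: "set_borel_measurable lborel S (\<lambda>x. f x + g x)"
    by (simp add: set_borel_measurable_def scaleR_add_right)
  show "set_integrable lborel S (\<lambda>x. (norm (f x + g x))\<^sup>2)"
  proof (rule set_integrable_bound)
    show "set_integrable lborel S (\<lambda>x. 2 * (norm (f x))\<^sup>2 + 2 * (norm (g x))\<^sup>2)"
      using assms by (intro set_integrable_mult_right set_integral_add L2_on_integrable) auto
    show "set_borel_measurable lborel S (\<lambda>x. (norm (f x + g x))\<^sup>2)"
      using set_borel_measurable_mult_inner[OF m m, of "\<lambda>_. 1"]
      by (simp add: power2_norm_eq_inner)
    have "(norm (f x + g x))\<^sup>2 \<le> 2 * (norm (f x))\<^sup>2 + 2 * (norm (g x))\<^sup>2" for x
    proof -
      have "(norm (f x + g x))\<^sup>2 \<le> (norm (f x) + norm (g x))\<^sup>2"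
        by (intro power_mono norm_triangle_ineq) simp
      also have "\<dots> \<le> 2 * (norm (f x))\<^sup>2 + 2 * (norm (g x))\<^sup>2"
        using sum_squares_bound[of "norm (f x)" "norm (g x)"] by (simp add: power2_sum)
      finally show ?thesis .
    qed
    then show "AE x in lborel. x \<in> S \<longrightarrow>
        norm ((norm (f x + g x))\<^sup>2) \<le> norm (2 * (norm (f x))\<^sup>2 + 2 * (norm (g x))\<^sup>2)"
      by simp
  qed
qed

lemma L2_on_diff: "L2_on S f \<Longrightarrow> L2_on S g \<Longrightarrow> L2_on S (\<lambda>x. f x - g x)"
  using L2_on_add[of S f "\<lambda>x. - g x"] L2_on_bounded_linear[of S g uminus]
  by (simp add: bounded_linear_minus)

text \<open>The optimal \<open>s = Y / X\<close> is not admissible when \<open>X\<close> or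
  \<open>Y\<close> vanishes. Shifting both by a small \<open>r\<close> avoids the case distinction,
  and the error disappears with \<open>r\<close>.\<close>

lemma le_mult_if_weighted_le:
  fixes I X Y :: real
  assumes "0 \<le> X" "0 \<le> Y" "\<And>s. 0 < s \<Longrightarrow> 2 * I \<le> s * X\<^sup>2 + Y\<^sup>2 / s"
  shows "I \<le> X * Y"
proof (rule field_le_epsilon)
  fix e :: real assume e: "0 < e"
  \<comment> \<open>\<open>r \<le> 1\<close> bounds \<open>r * r\<close> by \<open>r\<close>, so
    that \<open>(X + r) * (Y + r) \<le> X * Y + r * (X + Y + 1)\<close>; the second entry of the
    minimum makes the excess at most \<open>e\<close>.\<close>
  define r where "r = min 1 (e / (X + Y + 1))"
  have le: "r \<le> e / (X + Y + 1)" by (simp add: r_def)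
  have r: "0 < r" "r \<le> 1" using e assms(1,2) by (simp_all add: r_def)
  have re: "r * (X + Y + 1) \<le> e" using le assms(1,2) by (simp add: pos_le_divide_eq)
  have "2 * I \<le> (Y + r) / (X + r) * X\<^sup>2 + Y\<^sup>2 / ((Y + r) / (X + r))"
    using assms r by (intro assms(3)) (auto intro!: divide_pos_pos)
  also have "\<dots> \<le> (Y + r) / (X + r) * (X + r)\<^sup>2 + (Y + r)\<^sup>2 / ((Y + r) / (X + r))"
    using assms r by (intro add_mono mult_left_mono divide_right_mono power_mono) auto
  also have "\<dots> = 2 * ((X + r) * (Y + r))"
  proof -
    have "q / p * p\<^sup>2 + q\<^sup>2 / (q / p) = 2 * (p * q)" if "0 < p" "0 < q" for p q :: real
      using that by (simp add: field_simps power2_eq_square)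
    then show ?thesis using assms(1,2) r by simp
  qed
  also have "2 * ((X + r) * (Y + r)) \<le> 2 * (X * Y + r * (X + Y + 1))"
    using mult_left_mono[OF r(2), of r] r(1) by (simp add: algebra_simps)
  finally have "I \<le> X * Y + r * (X + Y + 1)"
    by (rule mult_left_le_imp_le) simp
  then show "I \<le> X * Y + e" using add_left_mono[OF re] by (rule order_trans)
qed

text \<open>Young's inequality is applied under the integral with a free parameter \<open>s\<close>,
  which is then optimised for \<open>X = B * L2_norm S f\<close> and \<open>Y = L2_norm S g\<close>.
  The bounded weight \<open>b\<close> accommodates a multiplier \<open>h\<close> and its
  derivative.\<close>

lemma L2_Cauchy_Schwarz:
  fixes f g :: "'a::euclidean_space \<Rightarrow> 'b::euclidean_space"
  assumes "L2_on S f" "L2_on S g" "b \<in> borel_measurable borel" "\<And>x. x \<in> S \<Longrightarrow> \<bar>b x\<bar> \<le> B" "0 \<le> B"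
  shows "\<bar>LINT x:S|lborel. b x * (f x \<bullet> g x)\<bar> \<le> B * (L2_norm S f * L2_norm S g)"
proof -
  have "2 * \<bar>LINT x:S|lborel. b x * (f x \<bullet> g x)\<bar>
      \<le> s * (B * L2_norm S f)\<^sup>2 + (L2_norm S g)\<^sup>2 / s" if s: "0 < s" for s
  proof -
    have int: "set_integrable lborel S (\<lambda>x. b x * (f x \<bullet> g x))"
      using assms by (intro L2_mult_inner_integrable)
    have "\<bar>LINT x:S|lborel. b x * (f x \<bullet> g x)\<bar> \<le> (LINT x:S|lborel. \<bar>b x * (f x \<bullet> g x)\<bar>)"
      using set_integral_norm_bound[OF int] by simp
    also have "\<dots> \<le> (LINT x:S|lborel. s * B\<^sup>2 / 2 * (norm (f x))\<^sup>2 + 1 / (2 * s) * (norm (g x))\<^sup>2)"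
    proof (rule set_integral_mono)
      show "\<bar>b x * (f x \<bullet> g x)\<bar> \<le> s * B\<^sup>2 / 2 * (norm (f x))\<^sup>2 + 1 / (2 * s) * (norm (g x))\<^sup>2"
        if "x \<in> S" for x
      proof -
        have "\<bar>b x * (f x \<bullet> g x)\<bar> \<le> B * (norm (f x) * norm (g x))"
          unfolding abs_mult using assms(4)[OF that] assms(5)
          by (intro mult_mono Cauchy_Schwarz_ineq2) auto
        also have "\<dots> \<le> s * B\<^sup>2 / 2 * (norm (f x))\<^sup>2 + 1 / (2 * s) * (norm (g x))\<^sup>2"
          using s zero_le_power2[of "s * B * norm (f x) - norm (g x)"]
          by (simp add: field_simps power2_eq_square)
        finally show ?thesis .
      qed
    qed (intro set_integrable_abs[OF int] set_integral_add(1) set_integrable_mult_right L2_on_integrable assms)+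
    also have "\<dots> = s * B\<^sup>2 / 2 * (L2_norm S f)\<^sup>2 + 1 / (2 * s) * (L2_norm S g)\<^sup>2"
      using assms by (simp add: L2_norm_power2 L2_on_integrable)
    finally show ?thesis using s by (simp add: field_simps)
  qed
  from le_mult_if_weighted_le[OF _ _ this] show ?thesis
    using assms(5) by (simp add: L2_norm_nonneg mult.assoc)
qed

section \<open>The period cell and continuous fields on it\<close>

lemma cell_subset: "(cell :: (real^'n) set) \<subseteq> cbox 0 1"
  by (auto simp: cell_def mem_box_cart less_imp_le)

lemma cell_eq_box: "(cell :: (real^'n) set) = box 0 1"
  by (auto simp: cell_def mem_box_cart)

lemma cell_measurable [measurable]: "(cell :: (real^'n) set) \<in> sets borel"
  by (simp add: cell_eq_box)

lemma measure_cell: "measure lborel (cell :: (real^'n) set) = 1"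
  and emeasure_cell: "emeasure lborel (cell :: (real^'n) set) = 1"
proof -
  have "(\<Prod>b\<in>Basis. (1 - 0 :: real^'n) \<bullet> b) = 1"
    by (rule prod.neutral) (auto simp: Basis_vec_def inner_axis)
  moreover have "0 \<le> (1::real^'n) \<bullet> b" if "b \<in> Basis" for b
    using that by (auto simp: Basis_vec_def inner_axis)
  ultimately show "measure lborel (cell :: (real^'n) set) = 1" "emeasure lborel (cell :: (real^'n) set) = 1"
    unfolding cell_eq_box by (simp_all add: emeasure_lborel_box_eq)
qed

lemma L2_on_cell_bounded:
  fixes f :: "real^'n \<Rightarrow> 'b::euclidean_space"
  assumes "f \<in> borel_measurable borel" "\<And>x. x \<in> cell \<Longrightarrow> norm (f x) \<le> B"
  shows "L2_on cell f"
  unfolding L2_on_def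
proof
  show m: "set_borel_measurable lborel cell f"
    using assms(1) unfolding set_borel_measurable_def by measurable
  show "set_integrable lborel cell (\<lambda>x. (norm (f x))\<^sup>2)"
  proof (rule set_integrable_bound)
    show "set_integrable lborel cell (\<lambda>x::real^'n. B\<^sup>2)"
      unfolding set_integrable_def by (simp add: emeasure_cell)
    show "set_borel_measurable lborel cell (\<lambda>x. (norm (f x))\<^sup>2)"
      using assms(1) unfolding set_borel_measurable_def by measurable
    show "AE x in lborel. x \<in> cell \<longrightarrow> norm ((norm (f x))\<^sup>2) \<le> norm (B\<^sup>2)"
      using power_mono[OF assms(2) norm_ge_zero, of _ 2] by auto
  qed
qed

lemma continuous_cell_bounded:
  fixes f :: "real^'n \<Rightarrow> 'b::euclidean_space"
  assumes "continuous_on UNIV f"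
  shows "\<exists>B\<ge>0. \<forall>x\<in>cell. norm (f x) \<le> B"
proof -
  have "compact (f ` cbox 0 1)"
    using assms by (intro compact_continuous_image) (auto intro: continuous_on_subset)
  then obtain B where B: "0 < B" "\<forall>y \<in> f ` cbox 0 1. norm y \<le> B"
    using compact_imp_bounded[of "f ` cbox 0 1"] unfolding bounded_pos by metis
  have "norm (f x) \<le> B" if "x \<in> cell" for x
    using B(2)[rule_format, OF imageI[OF subsetD[OF cell_subset that]]] .
  then show ?thesis using B(1) by (intro exI[of _ B]) simp
qed

lemma L2_on_cell_continuous:
  fixes f :: "real^'n \<Rightarrow> 'b::euclidean_space"
  assumes "continuous_on UNIV f"
  shows "L2_on cell f"
proof -
  obtain B where "\<forall>x\<in>cell. norm (f x) \<le> B"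
    using continuous_cell_bounded[OF assms] by metis
  with borel_measurable_continuous_onI[OF assms] show ?thesis by (intro L2_on_cell_bounded) auto
qed

section \<open>A weighted Poincare inequality at the walls\<close>

lemma set_integral_sum:
  fixes f :: "'i \<Rightarrow> 'a \<Rightarrow> 'b::{banach, second_countable_topology}"
  assumes "\<And>i. i \<in> I \<Longrightarrow> set_integrable M A (f i)"
  shows "(LINT x:A|M. \<Sum>i\<in>I. f i x) = (\<Sum>i\<in>I. LINT x:A|M. f i x)"
  using assms unfolding set_integrable_def set_lebesgue_integral_def
  by (simp add: scaleR_sum_right Bochner_Integration.integral_sum)

lemma norm_column_le:
  fixes M :: "real^'n^'m"
  shows "norm (column w M) \<le> norm M"
proof -
  have "norm (column w M) = L2_set (\<lambda>i. norm (M $ i $ w)) UNIV"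
    by (simp add: norm_vec_def column_def)
  also have "\<dots> \<le> L2_set (\<lambda>i. norm (M $ i)) UNIV"
    by (intro L2_set_mono) (simp_all add: component_le_norm_cart)
  finally show ?thesis by (simp add: norm_vec_def)
qed

lemma bounded_linear_column: "bounded_linear (column w :: real^'n^'m \<Rightarrow> real^'m)"
proof (rule bounded_linear_intro[where K = 1])
  show "norm (column w M) \<le> norm M * 1" for M :: "real^'n^'m" by (simp add: norm_column_le)
qed (simp_all add: column_def vec_eq_iff)

lemma jacobian_nth: "jacobian f (at x) $ i $ j = dir_deriv (axis j 1) f x $ i"
  by (simp add: jacobian_def matrix_def dir_deriv_def)

lemma column_jacobian: "column w (jacobian f (at x)) = dir_deriv (axis w 1) f x"
  by (simp add: column_def jacobian_nth vec_eq_iff)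

lemma continuous_on_jacobian:
  fixes f :: "real^'n \<Rightarrow> real^'m"
  assumes "smooth f"
  shows "continuous_on S (\<lambda>x. jacobian f (at x))"
proof -
  have eq: "jacobian f (at x) = (\<chi> i j. dir_deriv (axis j 1) f x $ i)" for x
    by (simp add: vec_eq_iff jacobian_nth)
  show ?thesis unfolding eq
    by (intro continuous_on_vec_lambda continuous_on_component smooth_continuous smooth_dir_deriv assms)
qed

section \<open>Multipliers depending on the wall-normal coordinate\<close>

lemma smooth_wall:
  fixes h :: "real \<Rightarrow> real"
  assumes "smooth h"
  shows "smooth (\<lambda>x :: real^'n. h (x $ w))"
  using smooth_affine[OF assms bounded_linear_vec_nth[of w], of 0] by simp

lemma dir_deriv_wall:
  assumes "(h has_real_derivative h') (at (x $ w))"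
  shows "dir_deriv v (\<lambda>x :: real^'n. h (x $ w)) x = h' * v $ w"
proof -
  have "((\<lambda>x :: real^'n. x $ w) has_derivative (\<lambda>v. v $ w)) (at x)"
    by (intro bounded_linear_imp_has_derivative bounded_linear_vec_nth)
  from has_derivative_compose[OF this assms[unfolded has_field_derivative_def]]
  show ?thesis by (rule dir_deriv_eq)
qed

lemma dir_deriv_nth: 
  fixes f :: "'a::euclidean_space \<Rightarrow> real^'n"
  assumes "smooth f"
  shows "dir_deriv v (\<lambda>x. f x $ i) x = dir_deriv v f x $ i"
  using dir_deriv_eq[OF bounded_linear.has_derivative[OF bounded_linear_vec_nth smooth_has_derivative[OF assms]]] .

text \<open>Component \<open>i\<close> is the weak gradient tested with
  \<open>h (x $ w) * \<phi> x $ i\<close>. As \<open>h\<close> depends on the wall-normal coordinate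
  alone, periodicity survives, and the support of \<open>\<phi>\<close> allows \<open>h\<close> to
  be nonzero at the walls.\<close>

lemma H10_test_identity:
  fixes f :: "real^'n \<Rightarrow> real^'n"
  assumes H: "H10 w f G" and h: "smooth h" "\<And>y. (h has_real_derivative h' y) (at y)"
    and hc: "continuous_on UNIV h'" and \<phi>: "space_test w \<phi>"
  shows "(LINT x:cell|lborel. h' (x $ w) * (f x \<bullet> \<phi> x) + h (x $ w) * (f x \<bullet> column w (jacobian \<phi> (at x)))
     + h (x $ w) * (column w (G x) \<bullet> \<phi> x)) = 0"
proof -
  have f: "L2_on cell f" and G: "L2_on cell G" and wg: "has_weak_gradient w f G"
    using H by (auto simp: H10_def)
  have s\<phi>: "smooth \<phi>" using \<phi> by (simp add: space_test_def)
  have c1: "continuous_on UNIV (\<lambda>x. h (x $ w) * dir_deriv (axis w 1) \<phi> x $ i + h' (x $ w) * \<phi> x $ i)" for i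
    by (intro continuous_intros smooth_continuous smooth_dir_deriv s\<phi> smooth_wall h(1)
        continuous_on_compose2[OF hc] continuous_on_component) auto
  have c2: "continuous_on UNIV (\<lambda>x. h (x $ w) * \<phi> x $ i)" for i
    by (intro continuous_intros smooth_continuous s\<phi> smooth_wall h(1))
  have fi: "L2_on cell (\<lambda>x. f x $ i)" for i
    by (rule L2_on_bounded_linear[OF f bounded_linear_vec_nth])
  have Gi: "L2_on cell (\<lambda>x. G x $ i $ w)" for i
    using L2_on_bounded_linear[OF L2_on_bounded_linear[OF G bounded_linear_vec_nth] bounded_linear_vec_nth] .
  have i1: "set_integrable lborel cell
      (\<lambda>x. f x $ i * (h (x $ w) * dir_deriv (axis w 1) \<phi> x $ i + h' (x $ w) * \<phi> x $ i))" for i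
    using L2_mult_inner_integrable[OF fi L2_on_cell_continuous[OF c1], of "\<lambda>_. 1" 1] by simp
  have i2: "set_integrable lborel cell (\<lambda>x. G x $ i $ w * (h (x $ w) * \<phi> x $ i))" for i
    using L2_mult_inner_integrable[OF Gi L2_on_cell_continuous[OF c2], of "\<lambda>_. 1" 1] by simp
  have comp: "(LINT x:cell|lborel. f x $ i * (h (x $ w) * dir_deriv (axis w 1) \<phi> x $ i + h' (x $ w) * \<phi> x $ i)
      + G x $ i $ w * (h (x $ w) * \<phi> x $ i)) = 0" for i
  proof -
    have s\<phi>i: "smooth (\<lambda>x. \<phi> x $ i)" using smooth_bounded_linear_image[OF s\<phi> bounded_linear_vec_nth] .
    define \<psi> where "\<psi> = (\<lambda>x. h (x $ w) * \<phi> x $ i)"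
    have "smooth \<psi>" unfolding \<psi>_def by (intro smooth_mult smooth_wall h(1) s\<phi>i)
    moreover have "tangentially_periodic w \<psi>"
      using \<phi> by (auto simp: \<psi>_def space_test_def tangentially_periodic_def axis_def)
    moreover have "\<exists>\<epsilon>>0. \<forall>x. \<psi> x \<noteq> 0 \<longrightarrow> \<epsilon> \<le> x $ w \<and> x $ w \<le> 1 - \<epsilon>"
    proof -
      obtain \<epsilon> where "\<epsilon> > 0" "\<And>x. \<phi> x \<noteq> 0 \<Longrightarrow> \<epsilon> \<le> x $ w \<and> x $ w \<le> 1 - \<epsilon>"
        using \<phi> unfolding space_test_def by metis
      moreover have "\<psi> x \<noteq> 0 \<Longrightarrow> \<phi> x \<noteq> 0" for x by (auto simp: \<psi>_def)
      ultimately show ?thesis by metis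
    qed
    ultimately have "space_test w \<psi>" by (simp add: space_test_def)
    then have "(LINT x:cell|lborel. f x $ i * dir_deriv (axis w 1) \<psi> x) =
        - (LINT x:cell|lborel. G x $ i $ w * \<psi> x)"
      using wg unfolding has_weak_gradient_def by blast
    moreover have "dir_deriv (axis w 1) \<psi> x = h (x $ w) * dir_deriv (axis w 1) \<phi> x $ i + h' (x $ w) * \<phi> x $ i" for x
      using dir_deriv_scaleR[OF smooth_wall[OF h(1), of w] s\<phi>i, of "axis w 1" x]
      by (simp add: \<psi>_def dir_deriv_wall[OF h(2)] dir_deriv_nth[OF s\<phi>])
    ultimately show ?thesis
      using set_integral_add(2)[OF i1 i2] by (simp add: \<psi>_def)
  qed
  have "(LINT x:cell|lborel. (\<Sum>i\<in>UNIV. f x $ i * (h (x $ w) * dir_deriv (axis w 1) \<phi> x $ i + h' (x $ w) * \<phi> x $ i)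
      + G x $ i $ w * (h (x $ w) * \<phi> x $ i))) = 0"
    using comp by (subst set_integral_sum) (intro set_integral_add(1) i1 i2, simp)
  moreover have "(\<Sum>i\<in>UNIV. f x $ i * (h (x $ w) * dir_deriv (axis w 1) \<phi> x $ i + h' (x $ w) * \<phi> x $ i)
      + G x $ i $ w * (h (x $ w) * \<phi> x $ i)) =
      h' (x $ w) * (f x \<bullet> \<phi> x) + h (x $ w) * (f x \<bullet> column w (jacobian \<phi> (at x)))
     + h (x $ w) * (column w (G x) \<bullet> \<phi> x)" for x
    by (simp add: column_jacobian inner_vec_def sum_distrib_left flip: sum.distrib)
      (simp add: column_def algebra_simps)
  ultimately show ?thesis by simp
qed

text \<open>Formally the wall-normal derivative of \<open>h |f|\<^sup>2\<close> is integrated across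
  the channel. The boundary terms vanish by the no-slip condition, which enters through the
  approximating test fields of \<open>H10\<close>.\<close>

lemma H10_identity:
  fixes f :: "real^'n \<Rightarrow> real^'n"
  assumes H: "H10 w f G" and h: "smooth h" "\<And>y. (h has_real_derivative h' y) (at y)"
    and hc: "continuous_on UNIV h'"
  shows "(LINT x:cell|lborel. h' (x $ w) * (f x \<bullet> f x) + 2 * (h (x $ w) * (f x \<bullet> column w (G x)))) = 0"
proof -
  have f: "L2_on cell f" and G: "L2_on cell G" using H by (auto simp: H10_def)
  obtain \<phi> where \<phi>: "\<And>k. space_test w (\<phi> k)"
    and l1: "(\<lambda>k. L2_norm cell (\<lambda>x. \<phi> k x - f x)) \<longlonglongrightarrow> 0"
    and l2: "(\<lambda>k. L2_norm cell (\<lambda>x. jacobian (\<phi> k) (at x) - G x)) \<longlonglongrightarrow> 0"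
    using H unfolding H10_def by blast
  have s\<phi>: "smooth (\<phi> k)" for k using \<phi> by (simp add: space_test_def)
  have hw: "continuous_on UNIV (\<lambda>x::real^'n. h (x $ w))"
    by (intro smooth_continuous smooth_wall h(1))
  have hw': "continuous_on UNIV (\<lambda>x::real^'n. h' (x $ w))"
    by (intro continuous_on_compose2[OF hc] continuous_on_component) auto
  note mh = borel_measurable_continuous_onI[OF hw] borel_measurable_continuous_onI[OF hw']
  obtain B1 where B1: "0 \<le> B1" "\<And>x::real^'n. x \<in> cell \<Longrightarrow> \<bar>h (x $ w)\<bar> \<le> B1"
    using continuous_cell_bounded[OF hw] unfolding real_norm_def by metis
  obtain B2 where B2: "0 \<le> B2" "\<And>x::real^'n. x \<in> cell \<Longrightarrow> \<bar>h' (x $ w)\<bar> \<le> B2"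
    using continuous_cell_bounded[OF hw'] unfolding real_norm_def by metis
  have cG: "L2_on cell (\<lambda>x. column w (G x))"
    by (rule L2_on_bounded_linear[OF G bounded_linear_column])
  have J: "L2_on cell (\<lambda>x. jacobian (\<phi> k) (at x))" for k
    by (intro L2_on_cell_continuous continuous_on_jacobian s\<phi>)
  have cJ: "L2_on cell (\<lambda>x. column w (jacobian (\<phi> k) (at x)))" for k
    by (rule L2_on_bounded_linear[OF J bounded_linear_column])
  have p: "L2_on cell (\<phi> k)" for k by (intro L2_on_cell_continuous smooth_continuous s\<phi>)
  define X where "X = (LINT x:cell|lborel. h' (x $ w) * (f x \<bullet> f x) + 2 * (h (x $ w) * (f x \<bullet> column w (G x))))"
  define e1 where "e1 k = L2_norm cell (\<lambda>x. \<phi> k x - f x)" for k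
  define e2 where "e2 k = L2_norm cell (\<lambda>x. jacobian (\<phi> k) (at x) - G x)" for k
  \<comment> \<open>Replacing one factor \<open>f\<close>, or its gradient, by the approximation
    gives the integral that vanishes by \<open>H10_test_identity\<close>. Hence \<open>- X\<close>
    is linear in the errors \<open>d\<close> and \<open>D\<close>, and Cauchy-Schwarz applies to
    each term.\<close>
  have bound: "\<bar>X\<bar> \<le> B2 * (L2_norm cell f * e1 k) + B1 * (L2_norm cell f * e2 k) + B1 * (L2_norm cell G * e1 k)" for k
  proof -
    define d where "d = (\<lambda>x. \<phi> k x - f x)"
    define D where "D = (\<lambda>x. column w (jacobian (\<phi> k) (at x) - G x))"
    have D_eq: "D x = column w (jacobian (\<phi> k) (at x)) - column w (G x)" for x
      by (simp add: D_def column_def vec_eq_iff)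
    have d: "L2_on cell d" unfolding d_def by (intro L2_on_diff p f)
    have JG: "L2_on cell (\<lambda>x. jacobian (\<phi> k) (at x) - G x)" by (intro L2_on_diff J G)
    have D: "L2_on cell D" unfolding D_def by (rule L2_on_bounded_linear[OF JG bounded_linear_column])
    have normcol: "L2_norm cell (\<lambda>x. column w (M x)) \<le> L2_norm cell M" if "L2_on cell M"
      for M :: "real^'n \<Rightarrow> real^'n^'n"
      unfolding L2_norm_def
      by (intro real_sqrt_le_mono set_integral_mono L2_on_integrable that power_mono norm_column_le
          L2_on_bounded_linear[OF that bounded_linear_column]) auto
    note I = L2_mult_inner_integrable
    have i1: "set_integrable lborel cell (\<lambda>x. h' (x $ w) * (f x \<bullet> f x) + 2 * (h (x $ w) * (f x \<bullet> column w (G x))))"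
      using I[OF f f mh(2) B2(2)] I[OF f cG mh(1) B1(2)] by simp
    have i2: "set_integrable lborel cell (\<lambda>x. h' (x $ w) * (f x \<bullet> \<phi> k x) +
        h (x $ w) * (f x \<bullet> column w (jacobian (\<phi> k) (at x))) + h (x $ w) * (column w (G x) \<bullet> \<phi> k x))"
      using I[OF f p mh(2) B2(2)] I[OF f cJ mh(1) B1(2)] I[OF cG p mh(1) B1(2)] by simp
    have "- X = (LINT x:cell|lborel. h' (x $ w) * (f x \<bullet> \<phi> k x) +
        h (x $ w) * (f x \<bullet> column w (jacobian (\<phi> k) (at x))) + h (x $ w) * (column w (G x) \<bullet> \<phi> k x)
        - (h' (x $ w) * (f x \<bullet> f x) + 2 * (h (x $ w) * (f x \<bullet> column w (G x)))))"
      using set_integral_diff(2)[OF i2 i1] H10_test_identity[OF H h hc \<phi>, of k] by (simp add: X_def)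
    also have "\<dots> = (LINT x:cell|lborel. h' (x $ w) * (f x \<bullet> d x) + h (x $ w) * (f x \<bullet> D x)
        + h (x $ w) * (column w (G x) \<bullet> d x))"
      by (simp add: d_def D_eq inner_diff_right inner_commute algebra_simps)
    also have "\<dots> = (LINT x:cell|lborel. h' (x $ w) * (f x \<bullet> d x)) + (LINT x:cell|lborel. h (x $ w) * (f x \<bullet> D x))
        + (LINT x:cell|lborel. h (x $ w) * (column w (G x) \<bullet> d x))"
      using I[OF f d mh(2) B2(2)] I[OF f D mh(1) B1(2)] I[OF cG d mh(1) B1(2)] by simp
    finally have "\<bar>X\<bar> \<le> \<bar>LINT x:cell|lborel. h' (x $ w) * (f x \<bullet> d x)\<bar> + \<bar>LINT x:cell|lborel. h (x $ w) * (f x \<bullet> D x)\<bar>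
        + \<bar>LINT x:cell|lborel. h (x $ w) * (column w (G x) \<bullet> d x)\<bar>" by linarith
    also have "\<dots> \<le> B2 * (L2_norm cell f * L2_norm cell d) + B1 * (L2_norm cell f * L2_norm cell D)
        + B1 * (L2_norm cell (\<lambda>x. column w (G x)) * L2_norm cell d)"
      by (intro add_mono L2_Cauchy_Schwarz f d D cG mh B1 B2)
    also have "\<dots> \<le> B2 * (L2_norm cell f * e1 k) + B1 * (L2_norm cell f * e2 k) + B1 * (L2_norm cell G * e1 k)"
      unfolding e1_def e2_def d_def[symmetric] D_def
      by (intro add_mono mult_left_mono mult_right_mono normcol G JG L2_norm_nonneg B1 order_refl)
    finally show ?thesis .
  qed
  have "(\<lambda>k. B2 * (L2_norm cell f * e1 k) + B1 * (L2_norm cell f * e2 k) + B1 * (L2_norm cell G * e1 k))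
      \<longlonglongrightarrow> B2 * (L2_norm cell f * 0) + B1 * (L2_norm cell f * 0) + B1 * (L2_norm cell G * 0)"
    unfolding e1_def e2_def by (intro tendsto_intros l1 l2)
  then have "\<bar>X\<bar> \<le> 0" using bound by (intro LIMSEQ_le_const) auto
  then show ?thesis by (simp add: X_def)
qed

text \<open>
  The weight is \<open>\<delta> h'\<close> for the multiplier \<open>h y = exp (- (1 - y) / \<delta>) - exp (- y / \<delta>)\<close>, which it also
  dominates. Hence the identity \<open>\<integral> h' |f|\<^sup>2 = - 2 \<integral> h f \<bullet> \<partial>\<^sub>w f\<close> controls a layer of width \<open>\<delta>\<close> at
  either wall by Young's inequality alone.
\<close>

definition wall_weight :: "real \<Rightarrow> real \<Rightarrow> real" where
  "wall_weight \<delta> y = exp (- y / \<delta>) + exp (- (1 - y) / \<delta>)"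

lemma wall_weight_pos: "0 < wall_weight \<delta> y"
  by (simp add: wall_weight_def add_pos_pos)

lemma wall_weight_le: "0 < \<delta> \<Longrightarrow> 0 \<le> y \<Longrightarrow> y \<le> 1 \<Longrightarrow> wall_weight \<delta> y \<le> 2"
  using add_mono[of "exp (- y / \<delta>)" 1 "exp (- (1 - y) / \<delta>)" 1]
  by (simp add: wall_weight_def divide_nonpos_pos)

lemma continuous_on_wall_weight [continuous_intros]: "continuous_on S (wall_weight \<delta>)"
  unfolding wall_weight_def divide_inverse by (intro continuous_intros)

lemma H10_wall_Poincare:
  fixes f :: "real^'n \<Rightarrow> real^'n"
  assumes H: "H10 w f G" and \<delta>: "0 < \<delta>"
  shows "(LINT x:cell|lborel. wall_weight \<delta> (x $ w) * (norm (f x))\<^sup>2) \<le> 8 * \<delta>\<^sup>2 * (L2_norm cell G)\<^sup>2"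
proof -
  have f: "L2_on cell f" and G: "L2_on cell G" using H by (auto simp: H10_def)
  have cG: "L2_on cell (\<lambda>x. column w (G x))"
    by (rule L2_on_bounded_linear[OF G bounded_linear_column])
  define h where "h y = exp (- (1 - y) / \<delta>) - exp (- y / \<delta>)" for y
  \<comment> \<open>Both exponents are spelled as \<open>m * y + a\<close> to match
    \<open>smooth_affine\<close>.\<close>
  have "smooth (\<lambda>y::real. exp (1 / \<delta> * y + (- 1 / \<delta>)) - exp ((- 1 / \<delta>) * y + 0))"
    by (intro smooth_diff smooth_affine smooth_exp bounded_linear_mult_right)
  also have "(\<lambda>y::real. exp (1 / \<delta> * y + (- 1 / \<delta>)) - exp ((- 1 / \<delta>) * y + 0)) = h"
    by (simp add: h_def fun_eq_iff diff_divide_distrib)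
  finally have h: "smooth h" .
  have h': "(h has_real_derivative wall_weight \<delta> y / \<delta>) (at y)" for y
    using \<delta> unfolding h_def wall_weight_def
    by (auto intro!: derivative_eq_intros simp: field_simps)
  have cw: "continuous_on UNIV (\<lambda>x::real^'n. wall_weight \<delta> (x $ w))"
    by (intro continuous_on_compose2[OF continuous_on_wall_weight] continuous_on_component) auto
  note mw = borel_measurable_continuous_onI[OF cw]
  have hw: "continuous_on UNIV (\<lambda>x::real^'n. h (x $ w))"
    by (intro smooth_continuous smooth_wall h)
  have w2: "\<bar>wall_weight \<delta> (x $ w)\<bar> \<le> 2" if "x \<in> cell" for x :: "real^'n"
    using wall_weight_le[OF \<delta>, of "x $ w"] wall_weight_pos[of \<delta> "x $ w"] that
    by (auto simp: cell_def less_imp_le)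
  have h2: "\<bar>h (x $ w)\<bar> \<le> wall_weight \<delta> (x $ w)" for x :: "real^'n"
    unfolding h_def wall_weight_def by (simp add: abs_le_iff)
  let ?X = "LINT x:cell|lborel. wall_weight \<delta> (x $ w) * (norm (f x))\<^sup>2"
  have iX: "set_integrable lborel cell (\<lambda>x. wall_weight \<delta> (x $ w) * (norm (f x))\<^sup>2)"
    using L2_mult_inner_integrable[OF f f mw w2] by (simp add: power2_norm_eq_inner)
  have ih: "set_integrable lborel cell (\<lambda>x. h (x $ w) * (f x \<bullet> column w (G x)))"
  proof (rule L2_mult_inner_integrable[OF f cG borel_measurable_continuous_onI[OF hw]])
    show "\<bar>h (x $ w)\<bar> \<le> 2" if "x \<in> cell" for x :: "real^'n"
      using h2[of x] w2[OF that] by linarith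
  qed
  have id: "(LINT x:cell|lborel. wall_weight \<delta> (x $ w) / \<delta> * (f x \<bullet> f x) + 2 * (h (x $ w) * (f x \<bullet> column w (G x)))) = 0"
    by (rule H10_identity[OF H h h']) (intro continuous_intros, use \<delta> in auto)
  have "?X / \<delta> + (LINT x:cell|lborel. 2 * (h (x $ w) * (f x \<bullet> column w (G x)))) =
     (LINT x:cell|lborel. (wall_weight \<delta> (x $ w) * (norm (f x))\<^sup>2) / \<delta> + 2 * (h (x $ w) * (f x \<bullet> column w (G x))))"
    using iX ih \<delta> by (subst set_integral_add(2)) auto
  also have "\<dots> = 0" using id by (simp add: power2_norm_eq_inner)
  finally have "?X = - (2 * \<delta>) * (LINT x:cell|lborel. h (x $ w) * (f x \<bullet> column w (G x)))"
    using \<delta> by (simp add: field_simps)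
  also have "\<dots> = (LINT x:cell|lborel. - (2 * \<delta>) * (h (x $ w) * (f x \<bullet> column w (G x))))"
    by (rule set_integral_mult_right[symmetric])
  \<comment> \<open>Young's inequality is balanced so that half of the weighted integral can move to
    the left. The other part carries \<open>2 * \<delta>\<^sup>2\<close> times the weight, which is
    at most 2; doubling \<open>4 * \<delta>\<^sup>2\<close> gives the constant 8.\<close>
  also have "\<dots> \<le> (LINT x:cell|lborel. 1 / 2 * (wall_weight \<delta> (x $ w) * (norm (f x))\<^sup>2) + 4 * \<delta>\<^sup>2 * (norm (G x))\<^sup>2)"
  proof (rule set_integral_mono)
    fix x :: "real^'n" assume x: "x \<in> cell"
    let ?a = "norm (f x)" and ?b = "norm (G x)" and ?S = "wall_weight \<delta> (x $ w)"
    have "\<bar>h (x $ w) * (f x \<bullet> column w (G x))\<bar> \<le> ?S * (?a * ?b)"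
      unfolding abs_mult
      by (intro mult_mono h2 order_trans[OF Cauchy_Schwarz_ineq2] mult_left_mono norm_column_le)
        (auto intro: less_imp_le wall_weight_pos)
    then have "- (2 * \<delta>) * (h (x $ w) * (f x \<bullet> column w (G x))) \<le> 2 * \<delta> * (?S * (?a * ?b))"
      using \<delta> mult_left_mono[of "- (h (x $ w) * (f x \<bullet> column w (G x)))" "?S * (?a * ?b)" "2 * \<delta>"]
      by (simp add: abs_le_iff)
    also have "\<dots> \<le> ?S * (1 / 2 * ?a\<^sup>2 + 2 * \<delta>\<^sup>2 * ?b\<^sup>2)"
    proof -
      have "2 * \<delta> * (?a * ?b) \<le> 1 / 2 * ?a\<^sup>2 + 2 * \<delta>\<^sup>2 * ?b\<^sup>2"
        using zero_le_power2[of "?a - 2 * \<delta> * ?b"] by (simp add: power2_eq_square algebra_simps)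
      from mult_left_mono[OF this, of ?S] show ?thesis
        using wall_weight_pos[of \<delta> "x $ w"] by (simp add: mult_ac less_imp_le)
    qed
    also have "\<dots> \<le> 1 / 2 * (?S * ?a\<^sup>2) + 4 * \<delta>\<^sup>2 * ?b\<^sup>2"
      using mult_right_mono[of ?S 2 "2 * \<delta>\<^sup>2 * ?b\<^sup>2"] w2[OF x] by (simp add: algebra_simps)
    finally show "- (2 * \<delta>) * (h (x $ w) * (f x \<bullet> column w (G x)))
        \<le> 1 / 2 * (?S * ?a\<^sup>2) + 4 * \<delta>\<^sup>2 * ?b\<^sup>2" .
  qed (intro set_integral_add(1) set_integrable_mult_right iX ih L2_on_integrable[OF G])+
  also have "\<dots> = 1 / 2 * ?X + 4 * \<delta>\<^sup>2 * (L2_norm cell G)\<^sup>2"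
    using iX L2_on_integrable[OF G] by (subst set_integral_add(2)) (auto simp: L2_norm_power2)
  finally show ?thesis by simp
qed

section \<open>Cut-off in time and the energy at the final time\<close>

lemma set_integral_Times:
  fixes f :: "'a::euclidean_space \<times> 'b::euclidean_space \<Rightarrow> real"
  assumes "set_integrable lborel (S \<times> R) f"
  shows "set_integrable lborel S (\<lambda>x. LINT y:R|lborel. f (x, y))"
    and "(LINT x:S|lborel. LINT y:R|lborel. f (x, y)) = (LINT z:S \<times> R|lborel. f z)"
proof -
  let ?h = "\<lambda>z. indicator (S \<times> R) z *\<^sub>R f z"
  have h: "integrable (lborel \<Otimes>\<^sub>M lborel) ?h"
    using assms by (simp add: set_integrable_def lborel_prod)
  have eq: "(LINT y|lborel. ?h (x, y)) = indicator S x *\<^sub>R (LINT y:R|lborel. f (x, y))" for x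
    by (simp add: set_lebesgue_integral_def indicator_times mult.assoc)
  show "set_integrable lborel S (\<lambda>x. LINT y:R|lborel. f (x, y))"
    using lborel_pair.integrable_fst'[OF h] unfolding eq set_integrable_def .
  show "(LINT x:S|lborel. LINT y:R|lborel. f (x, y)) = (LINT z:S \<times> R|lborel. f z)"
    using lborel_pair.integral_fst'[OF h] unfolding eq by (simp add: set_lebesgue_integral_def lborel_prod)
qed

lemma set_integral_Ioo_eq_Icc:
  fixes f :: "real \<Rightarrow> real"
  shows "(LINT t:{a<..<b}|lborel. f t) = (LINT t:{a..b}|lborel. f t)"
  by (rule set_integral_discrete_difference[where X = "{a, b}"]) auto

lemma set_integrable_Ioo_continuous:
  fixes f :: "real \<Rightarrow> real"
  assumes "continuous_on {a..b} f"
  shows "set_integrable lborel {a<..<b} f"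
  by (rule set_integrable_subset[OF borel_integrable_atLeastAtMost'[OF assms]]) auto

context smooth_step
begin

text \<open>The argument is \<open>(T - \<epsilon> - t) / \<epsilon>\<close> in affine form: the
  cut-off is 1 up to \<open>T - 2 * \<epsilon>\<close> and 0 from \<open>T - \<epsilon>\<close> on,
  as a \<open>time_test\<close> must be. Minus its derivative is \<open>time_bump\<close>, a unit
  mass just before \<open>T\<close>.\<close>

definition time_cut :: "real \<Rightarrow> real \<Rightarrow> real \<Rightarrow> real" where
  "time_cut T \<epsilon> t = H ((- 1 / \<epsilon>) * t + (T - \<epsilon>) / \<epsilon>)"

definition time_bump :: "real \<Rightarrow> real \<Rightarrow> real \<Rightarrow> real" where
  "time_bump T \<epsilon> t = b ((- 1 / \<epsilon>) * t + (T - \<epsilon>) / \<epsilon>) / \<epsilon>"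

lemma smooth_time_cut: "smooth (time_cut T \<epsilon>)"
  unfolding time_cut_def by (intro smooth_affine smooth bounded_linear_mult_right)

lemma time_cut_has_derivative:
  "(time_cut T \<epsilon> has_real_derivative - time_bump T \<epsilon> t) (at t)"
  unfolding time_cut_def time_bump_def
  using DERIV_chain2[OF has_derivative
      DERIV_add[OF DERIV_cmult_Id[of "- 1 / \<epsilon>"] DERIV_const[of "(T - \<epsilon>) / \<epsilon>"]], of t UNIV] by simp

lemma time_cut_bounds: "0 \<le> time_cut T \<epsilon> t" "time_cut T \<epsilon> t \<le> 1"
  by (simp_all add: time_cut_def nonneg le_1)

lemma time_cut_argument:
  fixes T \<epsilon> t :: real
  shows "0 < \<epsilon> \<Longrightarrow> (- 1 / \<epsilon>) * t + (T - \<epsilon>) / \<epsilon> = (T - \<epsilon> - t) / \<epsilon>"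
  by (simp add: field_simps)

lemma time_cut_eq_0: "0 < \<epsilon> \<Longrightarrow> T - \<epsilon> \<le> t \<Longrightarrow> time_cut T \<epsilon> t = 0"
  unfolding time_cut_def by (rule eq_0) (simp only: time_cut_argument, simp add: divide_nonpos_pos)

lemma time_cut_eq_1: "0 < \<epsilon> \<Longrightarrow> t \<le> T - 2 * \<epsilon> \<Longrightarrow> time_cut T \<epsilon> t = 1"
  unfolding time_cut_def by (rule eq_1) (simp only: time_cut_argument, simp add: le_divide_eq)

lemma time_test_time_cut: "0 < \<epsilon> \<Longrightarrow> time_test T (time_cut T \<epsilon>)"
  unfolding time_test_def using smooth_time_cut time_cut_eq_0 by (metis linear)

lemma time_bump_nonneg: "0 < \<epsilon> \<Longrightarrow> 0 \<le> time_bump T \<epsilon> t"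
  by (simp add: time_bump_def bump_nonneg)

lemma time_bump_le: "0 < \<epsilon> \<Longrightarrow> time_bump T \<epsilon> t \<le> K / \<epsilon>"
  by (simp add: time_bump_def bump_le divide_right_mono)

lemma time_bump_eq_0: "0 < \<epsilon> \<Longrightarrow> t \<le> T - 2 * \<epsilon> \<Longrightarrow> time_bump T \<epsilon> t = 0"
  unfolding time_bump_def by (subst bump_eq_0) (simp only: time_cut_argument, simp_all add: le_divide_eq)

lemma continuous_on_time_bump: "continuous_on S (time_bump T \<epsilon>)"
  unfolding time_bump_def divide_inverse
  by (intro continuous_intros continuous_on_compose2[OF continuous_bump]) auto

lemma integral_time_bump:
  assumes "0 < \<epsilon>" "2 * \<epsilon> \<le> T"
  shows "(LINT t:{0<..<T}|lborel. time_bump T \<epsilon> t) = 1"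
proof -
  have D: "((\<lambda>t. - time_cut T \<epsilon> t) has_vector_derivative time_bump T \<epsilon> t) (at t within S)" for t S
    using DERIV_minus[OF time_cut_has_derivative, of T \<epsilon> t]
    by (auto simp flip: has_real_derivative_iff_has_vector_derivative intro: has_field_derivative_at_within)
  have "(LINT t:{0<..<T}|lborel. time_bump T \<epsilon> t) = (- time_cut T \<epsilon> T) - (- time_cut T \<epsilon> 0)"
    unfolding set_integral_Ioo_eq_Icc unfolding set_lebesgue_integral_def
    using assms by (intro integral_FTC_atLeastAtMost continuous_on_time_bump D) simp
  then show ?thesis using assms by (simp add: time_cut_eq_0 time_cut_eq_1)
qed

text \<open>The bumps concentrate at \<open>T\<close> from the left with total mass one, so
  continuity of \<open>g\<close> up to \<open>T\<close> is enough. The shift by 2 in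
  \<open>T / real (n + 2)\<close> keeps the whole mass inside the time interval for every
  \<open>n\<close>, including 0.\<close>

lemma time_average_tendsto:
  assumes T: "0 < T" and g: "continuous_on {0..T} g"
  shows "(\<lambda>n. LINT t:{0<..<T}|lborel. time_bump T (T / real (n + 2)) t * g t) \<longlonglongrightarrow> g T"
proof (rule LIMSEQ_I)
  fix r :: real assume r: "0 < r"
  obtain d where d: "0 < d" "\<And>t. t \<in> {0..T} \<Longrightarrow> dist t T < d \<Longrightarrow> dist (g t) (g T) < r / 2"
    using g T r unfolding continuous_on_iff by (metis atLeastAtMost_iff half_gt_zero less_imp_le order_refl)
  obtain N where N: "2 * T / d < real N" using reals_Archimedean2 by blast
  show "\<exists>no. \<forall>n\<ge>no. norm ((LINT t:{0<..<T}|lborel. time_bump T (T / real (n + 2)) t * g t) - g T) < r"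
  proof (intro exI allI impI)
    fix n assume n: "N \<le> n"
    let ?I = "{0<..<T}"
    define e where "e = T / real (n + 2)"
    have e: "0 < e" "2 * e \<le> T" using T by (simp_all add: e_def field_simps)
    have "2 * T < d * real (n + 2)"
    proof -
      have "2 * T / d < real (n + 2)" using N n by linarith
      then show ?thesis using d(1) by (simp add: field_simps)
    qed
    then have ed: "2 * e < d" by (simp add: e_def field_simps)
    have i: "set_integrable lborel ?I (\<lambda>t. time_bump T e t * f t)" if "continuous_on {0..T} f" for f
      by (intro set_integrable_Ioo_continuous continuous_on_mult continuous_on_time_bump that)
    note i1 = i[OF g] and i2 = i[OF continuous_on_const, of "g T"]
    have i3: "set_integrable lborel ?I (\<lambda>t. time_bump T e t * (g t - g T))"
      by (intro i continuous_intros g)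
    have "(LINT t:?I|lborel. time_bump T e t * g t) - g T =
        (LINT t:?I|lborel. time_bump T e t * (g t - g T))"
      using set_integral_diff(2)[OF i1 i2] integral_time_bump[OF e] by (simp add: right_diff_distrib)
    also have "norm \<dots> \<le> (LINT t:?I|lborel. norm (time_bump T e t * (g t - g T)))"
      by (rule set_integral_norm_bound[OF i3])
    also have "\<dots> \<le> (LINT t:?I|lborel. time_bump T e t * (r / 2))"
    proof (rule set_integral_mono)
      show "norm (time_bump T e t * (g t - g T)) \<le> time_bump T e t * (r / 2)" if t: "t \<in> ?I" for t
      proof (cases "t \<le> T - 2 * e")
        case True
        then show ?thesis by (simp add: time_bump_eq_0[OF e(1)])
      next
        case False
        then have "dist t T < d" using t ed by (simp add: dist_real_def)
        then have "\<bar>g t - g T\<bar> \<le> r / 2" using d(2)[of t] t by (simp add: dist_real_def)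
        from mult_left_mono[OF this time_bump_nonneg[OF e(1)]] show ?thesis
          using time_bump_nonneg[OF e(1)] by (simp add: abs_mult)
      qed
    qed (use set_integrable_abs[OF i3] i[OF continuous_on_const] in auto)
    also have "\<dots> < r" using integral_time_bump[OF e] r by simp
    finally show "norm ((LINT t:?I|lborel. time_bump T (T / real (n + 2)) t * g t) - g T) < r"
      unfolding e_def .
  qed
qed

text \<open>Dominated convergence: at a fixed \<open>t < T\<close> the cut-offs are eventually 1,
  and they never exceed 1.\<close>

lemma time_cut_tendsto:
  assumes T: "0 < T" and g: "set_integrable lborel {0<..<T} g"
  shows "(\<lambda>n. LINT t:{0<..<T}|lborel. time_cut T (T / real (n + 2)) t * g t)
    \<longlonglongrightarrow> (LINT t:{0<..<T}|lborel. g t)"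
  unfolding set_lebesgue_integral_def
proof (rule integral_dominated_convergence[where w = "\<lambda>t. norm (indicator {0<..<T} t *\<^sub>R g t)"])
  have cm: "time_cut T \<epsilon> \<in> borel_measurable borel" for \<epsilon>
    by (intro borel_measurable_continuous_onI smooth_continuous smooth_time_cut)
  have gm: "(\<lambda>t. indicator {0<..<T} t *\<^sub>R g t) \<in> borel_measurable lborel"
    using g unfolding set_integrable_def by (rule borel_measurable_integrable)
  show "(\<lambda>t. indicator {0<..<T} t *\<^sub>R g t) \<in> borel_measurable lborel" by (rule gm)
  show "(\<lambda>t. indicator {0<..<T} t *\<^sub>R (time_cut T (T / real (n + 2)) t * g t)) \<in> borel_measurable lborel" for n
    using borel_measurable_times[OF _ gm, of "time_cut T (T / real (n + 2))"] cm by (simp add: mult_ac)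
  show "integrable lborel (\<lambda>t. norm (indicator {0<..<T} t *\<^sub>R g t))"
    using g unfolding set_integrable_def by (rule integrable_norm)
  have "(\<lambda>n. indicator {0<..<T} t *\<^sub>R (time_cut T (T / real (n + 2)) t * g t))
      \<longlonglongrightarrow> indicator {0<..<T} t *\<^sub>R g t" for t
  proof (cases "t < T")
    case True
    obtain N where N: "2 * T / (T - t) < real N" using reals_Archimedean2 by blast
    have "time_cut T (T / real (n + 2)) t = 1" if "N \<le> n" for n
    proof (rule time_cut_eq_1)
      have "2 * T / (T - t) < real (n + 2)" using N that by linarith
      then have "2 * T < (T - t) * real (n + 2)" using True by (simp add: field_simps)
      then have "2 * T / real (n + 2) < T - t" by (subst pos_divide_less_eq) simp_all
      then show "t \<le> T - 2 * (T / real (n + 2))" by simp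
    qed (use T in simp)
    then have "\<forall>\<^sub>F n in sequentially. indicator {0<..<T} t *\<^sub>R g t =
        indicator {0<..<T} t *\<^sub>R (time_cut T (T / real (n + 2)) t * g t)"
      by (intro eventually_sequentiallyI[of N]) simp
    then show ?thesis by (rule Lim_transform_eventually[OF tendsto_const])
  qed simp
  then show "AE t in lborel. (\<lambda>n. indicator {0<..<T} t *\<^sub>R (time_cut T (T / real (n + 2)) t * g t))
      \<longlonglongrightarrow> indicator {0<..<T} t *\<^sub>R g t" by simp
  show "AE t in lborel. norm (indicator {0<..<T} t *\<^sub>R (time_cut T (T / real (n + 2)) t * g t))
      \<le> norm (indicator {0<..<T} t *\<^sub>R g t)" for n
  proof (rule AE_I2)
    have "\<bar>time_cut T \<epsilon> t * g t\<bar> \<le> \<bar>g t\<bar>" for t \<epsilon>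
      using mult_right_mono[OF time_cut_bounds(2) abs_ge_zero] time_cut_bounds(1)
      by (simp add: abs_mult)
    then show "norm (indicator {0<..<T} t *\<^sub>R (time_cut T (T / real (n + 2)) t * g t))
      \<le> norm (indicator {0<..<T} t *\<^sub>R g t)" for t
      unfolding norm_scaleR by (intro mult_left_mono) (simp_all only: real_norm_def abs_ge_zero)
  qed
qed

lemma deriv_time_cut: "deriv (time_cut T \<epsilon>) t = - time_bump T \<epsilon> t"
  by (rule DERIV_imp_deriv[OF time_cut_has_derivative])

lemma L2_norm_Times:
  fixes F :: "real \<Rightarrow> real^'n \<Rightarrow> 'b::euclidean_space"
  assumes "L2_on (I \<times> cell) (\<lambda>(t, x). F t x)"
  shows "set_integrable lborel I (\<lambda>t. (L2_norm cell (F t))\<^sup>2)"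
    and "(LINT t:I|lborel. (L2_norm cell (F t))\<^sup>2) = (L2_norm (I \<times> cell) (\<lambda>(t, x). F t x))\<^sup>2"
  using set_integral_Times[OF L2_on_integrable[OF assms]] by (simp_all add: L2_norm_power2)

text \<open>Testing the distributional inequality with a cut-off bounds an average of the energy
  just before \<open>T\<close>. Passing to the value at \<open>T\<close> needs this average from
  below only, so no continuity of the energy itself is involved.\<close>

lemma energy_at_end:
  fixes u :: "real \<Rightarrow> real^'n \<Rightarrow> real^'n"
  assumes T: "0 < T" and lh: "leray_hopf w \<nu> T u G"
  shows "(L2_norm cell (u T))\<^sup>2 + 2 * \<nu> * (L2_norm ({0<..<T} \<times> cell) (\<lambda>(t, x). G t x))\<^sup>2
    \<le> (L2_norm cell (u 0))\<^sup>2"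
proof -
  have wc: "weakly_continuous T u" and u: "L2_on ({0<..<T} \<times> cell) (\<lambda>(t, x). u t x)"
    and G: "L2_on ({0<..<T} \<times> cell) (\<lambda>(t, x). G t x)" and E: "energy_inequality \<nu> T u G"
    using lh by (auto simp: leray_hopf_def weak_solution_def)
  have ut: "L2_on cell (u t)" if "t \<in> {0..T}" for t
    using wc that unfolding weakly_continuous_def by blast
  have uT: "L2_on cell (u T)" using ut T by simp
  \<comment> \<open>Weak lower semicontinuity of the energy: \<open>g\<close> is continuous and touches it from below at \<open>T\<close>.\<close>
  define g where "g t = 2 * (LINT x:cell|lborel. u t x \<bullet> u T x) - (L2_norm cell (u T))\<^sup>2" for t
  have g: "continuous_on {0..T} g"
    unfolding g_def using wc uT by (auto simp: weakly_continuous_def intro!: continuous_intros)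
  have gT: "g T = (L2_norm cell (u T))\<^sup>2" by (simp add: g_def L2_norm_power2 power2_norm_eq_inner)
  have gle: "g t \<le> (L2_norm cell (u t))\<^sup>2" if t: "t \<in> {0..T}" for t
  proof -
    have i: "set_integrable lborel cell (\<lambda>x. u t x \<bullet> u T x)"
      using L2_mult_inner_integrable[OF ut[OF t] uT, of "\<lambda>_. 1" 1] by simp
    have "2 * (LINT x:cell|lborel. u t x \<bullet> u T x) = (LINT x:cell|lborel. 2 * (u t x \<bullet> u T x))" by simp
    also have "\<dots> \<le> (LINT x:cell|lborel. (norm (u t x))\<^sup>2 + (norm (u T x))\<^sup>2)"
    proof (rule set_integral_mono)
      show "2 * (u t x \<bullet> u T x) \<le> (norm (u t x))\<^sup>2 + (norm (u T x))\<^sup>2" for x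
        using zero_le_power2[of "norm (u t x - u T x)"] by (simp add: power2_norm_eq_inner inner_diff inner_commute)
    qed (intro set_integrable_mult_right i set_integral_add(1) L2_on_integrable ut t uT)+
    also have "\<dots> = (L2_norm cell (u t))\<^sup>2 + (L2_norm cell (u T))\<^sup>2"
      using L2_on_integrable[OF ut[OF t]] L2_on_integrable[OF uT] by (simp add: L2_norm_power2)
    finally show ?thesis by (simp add: g_def)
  qed
  let ?e = "\<lambda>n. T / real (n + 2)" and ?I = "{0<..<T}"
  have "(LINT t:?I|lborel. time_bump T (?e n) t * g t)
      + 2 * \<nu> * (LINT t:?I|lborel. time_cut T (?e n) t * (L2_norm cell (G t))\<^sup>2) \<le> (L2_norm cell (u 0))\<^sup>2" for n
  proof -
    have e: "0 < ?e n" "2 * ?e n \<le> T" using T by (simp_all add: field_simps)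
    have "(LINT t:?I|lborel. time_bump T (?e n) t * g t)
        \<le> (LINT t:?I|lborel. time_bump T (?e n) t * (L2_norm cell (u t))\<^sup>2)"
    proof (rule set_integral_mono)
      show "set_integrable lborel ?I (\<lambda>t. time_bump T (?e n) t * g t)"
        by (intro set_integrable_Ioo_continuous continuous_on_mult continuous_on_time_bump g)
      show "set_integrable lborel ?I (\<lambda>t. time_bump T (?e n) t * (L2_norm cell (u t))\<^sup>2)"
      proof (rule set_integrable_bound)
        show "set_integrable lborel ?I (\<lambda>t. K / ?e n * (L2_norm cell (u t))\<^sup>2)"
          by (intro set_integrable_mult_right L2_norm_Times(1) u)
        have m: "(\<lambda>t. indicator ?I t *\<^sub>R (L2_norm cell (u t))\<^sup>2) \<in> borel_measurable lborel"
          using L2_norm_Times(1)[OF u] unfolding set_integrable_def by (rule borel_measurable_integrable)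
        have bm: "time_bump T (?e n) \<in> borel_measurable lborel"
          using borel_measurable_continuous_onI[OF continuous_on_time_bump] by simp
        show "set_borel_measurable lborel ?I (\<lambda>t. time_bump T (?e n) t * (L2_norm cell (u t))\<^sup>2)"
          using borel_measurable_times[OF bm m] unfolding set_borel_measurable_def by (simp add: mult_ac)
        have "\<bar>time_bump T (?e n) t * (L2_norm cell (u t))\<^sup>2\<bar> \<le> \<bar>K / ?e n * (L2_norm cell (u t))\<^sup>2\<bar>" for t
          unfolding abs_mult using time_bump_nonneg[OF e(1)] order_trans[OF time_bump_le[OF e(1)] abs_ge_self]
          by (intro mult_right_mono) simp_all
        then show "AE t in lborel. t \<in> ?I \<longrightarrow> norm (time_bump T (?e n) t * (L2_norm cell (u t))\<^sup>2)
            \<le> norm (K / ?e n * (L2_norm cell (u t))\<^sup>2)" by (intro AE_I2 impI) (simp only: real_norm_def)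
      qed
    qed (use gle time_bump_nonneg[OF e(1)] in \<open>auto intro!: mult_left_mono\<close>)
    moreover have "- (1/2) * (LINT t:?I|lborel. deriv (time_cut T (?e n)) t * (L2_norm cell (u t))\<^sup>2)
          - (1/2) * time_cut T (?e n) 0 * (L2_norm cell (u 0))\<^sup>2
        \<le> - \<nu> * (LINT t:?I|lborel. time_cut T (?e n) t * (L2_norm cell (G t))\<^sup>2)"
      using E time_test_time_cut[OF e(1)] time_cut_bounds unfolding energy_inequality_def by blast
    moreover have "(LINT t:?I|lborel. deriv (time_cut T (?e n)) t * (L2_norm cell (u t))\<^sup>2)
        = - (LINT t:?I|lborel. time_bump T (?e n) t * (L2_norm cell (u t))\<^sup>2)"
      by (simp add: deriv_time_cut set_lebesgue_integral_def)
    \<comment> \<open>\<open>2 * ?e n \<le> T\<close> puts time 0 where the cut-off is 1, so exactly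
      the initial energy appears.\<close>
    moreover have "time_cut T (?e n) 0 = 1" using e by (intro time_cut_eq_1) auto
    ultimately show ?thesis by simp
  qed
  moreover have "(\<lambda>n. (LINT t:?I|lborel. time_bump T (?e n) t * g t)
      + 2 * \<nu> * (LINT t:?I|lborel. time_cut T (?e n) t * (L2_norm cell (G t))\<^sup>2))
      \<longlonglongrightarrow> g T + 2 * \<nu> * (LINT t:?I|lborel. (L2_norm cell (G t))\<^sup>2)"
    by (intro tendsto_intros time_average_tendsto time_cut_tendsto T g L2_norm_Times(1) G)
  ultimately have "g T + 2 * \<nu> * (LINT t:?I|lborel. (L2_norm cell (G t))\<^sup>2) \<le> (L2_norm cell (u 0))\<^sup>2"
    by (intro LIMSEQ_le_const2) auto
  then show ?thesis by (simp add: gT L2_norm_Times(2)[OF G])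
qed

end

section \<open>Cut-off in space and the momentum balance\<close>

lemma measure_slab:
  fixes w :: "'n::finite"
  assumes "0 \<le> a" "a \<le> b" "b \<le> 1"
  shows "measure lborel (cbox (\<chi> i. if i = w then a else 0) (\<chi> i. if i = w then b else 1) :: (real^'n) set) = b - a"
proof -
  have "cbox (\<chi> i. if i = w then a else 0) (\<chi> i. if i = w then b else 1) \<noteq> ({} :: (real^'n) set)"
    using assms by (auto simp: interval_ne_empty_cart)
  then have "measure lborel (cbox (\<chi> i. if i = w then a else 0) (\<chi> i. if i = w then b else 1) :: (real^'n) set)
      = (\<Prod>i\<in>UNIV. if i = w then b - a else 1)"
    by (simp add: content_cbox_cart if_distrib[of "\<lambda>x. x - _"] cong: if_cong)
  then show ?thesis by (simp add: prod.delta)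
qed

text \<open>The integrand lives in two slabs of thickness \<open>2 * \<delta>\<close>, one at each
  wall; \<open>B\<close> times the sum of their indicators dominates it.\<close>

lemma layer_integral_le:
  fixes w :: "'n::finite"
  assumes q: "continuous_on UNIV q" "\<And>y. 0 \<le> q y" "\<And>y. q y \<le> B"
    and q0: "\<And>y. 2 * \<delta> \<le> y \<Longrightarrow> y \<le> 1 - 2 * \<delta> \<Longrightarrow> q y = 0" and \<delta>: "0 < \<delta>" "\<delta> \<le> 1/4"
  shows "(LINT x:cell|lborel. q (x $ w :: real)) \<le> 4 * \<delta> * B"
    (is "set_lebesgue_integral _ (cell :: (real^'n) set) _ \<le> _")
proof -
  let ?C1 = "cbox (\<chi> i. if i = w then 0 else 0) (\<chi> i. if i = w then 2 * \<delta> else 1) :: (real^'n) set"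
  let ?C2 = "cbox (\<chi> i. if i = w then 1 - 2 * \<delta> else 0) (\<chi> i. if i = w then 1 else 1) :: (real^'n) set"
  have B: "0 \<le> B" using q(2,3) order_trans by blast
  have cq: "continuous_on UNIV (\<lambda>x::real^'n. q (x $ w))"
    by (intro continuous_on_compose2[OF q(1)] continuous_on_component) auto
  have i1: "integrable lborel (indicator ?C1 :: _ \<Rightarrow> real)" "integrable lborel (indicator ?C2 :: _ \<Rightarrow> real)"
    by (intro integrable_real_indicator emeasure_lborel_cbox_finite; simp)+
  have "set_integrable lborel cell (\<lambda>x::real^'n. q (x $ w))"
    using L2_mult_inner_integrable[OF L2_on_cell_continuous[OF continuous_on_const[of _ "1::real"]]
        L2_on_cell_continuous[OF cq], of "\<lambda>_. 1" 1] by simp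
  then have "(LINT x:cell|lborel. q ((x::real^'n) $ w)) \<le> (LINT x|lborel. B * indicator ?C1 x + B * indicator ?C2 x)"
    unfolding set_lebesgue_integral_def set_integrable_def
  proof (rule integral_mono)
    show "integrable lborel (\<lambda>x. B * indicator ?C1 x + B * indicator ?C2 x)"
      using i1 by simp
    show "indicator cell x *\<^sub>R q (x $ w) \<le> B * indicator ?C1 x + B * indicator ?C2 x" for x :: "real^'n"
    proof (cases "x \<in> cell \<and> q (x $ w) \<noteq> 0")
      case True
      then have x: "\<And>i. 0 < x $ i" "\<And>i. x $ i < 1" by (auto simp: cell_def)
      have "x $ w < 2 * \<delta> \<or> 1 - 2 * \<delta> < x $ w" using True q0[of "x $ w"] by force
      then have "x \<in> ?C1 \<or> x \<in> ?C2" using x by (auto simp: mem_box_cart less_imp_le)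
      then have "1 \<le> indicator ?C1 x + (indicator ?C2 x :: real)" by (auto simp: indicator_def)
      from mult_left_mono[OF this B] show ?thesis using True q(3)[of "x $ w"] by (simp add: distrib_left)
    next
      case False
      then have "indicator cell x *\<^sub>R q (x $ w) = 0" by auto
      then show ?thesis using B by (simp only:) (simp add: add_nonneg_nonneg)
    qed
  qed
  also have "\<dots> = B * measure lborel ?C1 + B * measure lborel ?C2"
    using i1 by simp
  also have "\<dots> = 4 * \<delta> * B"
    using \<delta> measure_slab[of 0 "2 * \<delta>" w] measure_slab[of "1 - 2 * \<delta>" 1 w] by (simp add: algebra_simps)
  finally show ?thesis .
qed

context smooth_step
begin

lemma K_nonneg: "0 \<le> K"
  using bump_nonneg bump_le order_trans by blast

text \<open>A rising plus a falling step minus 1 instead of their product: for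
  \<open>\<delta> \<le> 1/4\<close> one of the two is 1 at every point, so both forms agree, and the
  sum differentiates without mixed terms. The rise takes place between \<open>\<delta>\<close> and
  \<open>2 * \<delta>\<close>, which leaves a free strip at the wall as test fields require.\<close>

definition wall_cut :: "real \<Rightarrow> real \<Rightarrow> real" where
  "wall_cut \<delta> y = H ((1 / \<delta>) * y + (- 1)) + H ((- 1 / \<delta>) * y + (1 - \<delta>) / \<delta>) - 1"

definition wall_slope :: "real \<Rightarrow> real \<Rightarrow> real" where
  "wall_slope \<delta> y = (b ((1 / \<delta>) * y + (- 1)) - b ((- 1 / \<delta>) * y + (1 - \<delta>) / \<delta>)) / \<delta>"

lemma smooth_wall_cut: "smooth (wall_cut \<delta>)"
  unfolding wall_cut_def
  by (rule smooth_diff[OF smooth_add smooth_const]; rule smooth_affine[OF smooth bounded_linear_mult_right])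

lemma wall_cut_has_derivative: "(wall_cut \<delta> has_real_derivative wall_slope \<delta> y) (at y)"
proof -
  have D: "((\<lambda>y. H (m * y + a)) has_real_derivative b (m * y + a) * m) (at y)" for m a y
    using DERIV_chain2[OF has_derivative DERIV_add[OF DERIV_cmult_Id[of m] DERIV_const[of a]], of y UNIV] by simp
  show ?thesis unfolding wall_cut_def wall_slope_def
    by (rule DERIV_cong[OF DERIV_diff[OF DERIV_add[OF D[of "1 / \<delta>" "- 1" y] D[of "- 1 / \<delta>" "(1 - \<delta>) / \<delta>" y]] DERIV_const]]) (simp add: diff_divide_distrib)
qed

lemma continuous_on_wall_slope: "continuous_on S (wall_slope \<delta>)"
  unfolding wall_slope_def divide_inverse
  by (intro continuous_intros continuous_on_compose2[OF continuous_bump]) auto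

context
  fixes \<delta> :: real
  assumes \<delta>: "0 < \<delta>" "\<delta> \<le> 1/4"
begin

lemma left_argument: "(1 / \<delta>) * y + (- 1) = (y - \<delta>) / \<delta>"
  using \<delta> by (simp add: field_simps)

lemma right_argument: "(- 1 / \<delta>) * y + (1 - \<delta>) / \<delta> = (1 - \<delta> - y) / \<delta>"
  using \<delta> by (simp add: field_simps)

lemma wall_cut_lower: "y \<le> 1 - 2 * \<delta> \<Longrightarrow> wall_cut \<delta> y = H ((y - \<delta>) / \<delta>)"
  unfolding wall_cut_def left_argument right_argument using \<delta> by (simp add: eq_1 le_divide_eq)

lemma wall_cut_upper: "2 * \<delta> \<le> y \<Longrightarrow> wall_cut \<delta> y = H ((1 - \<delta> - y) / \<delta>)"
  unfolding wall_cut_def left_argument right_argument using \<delta> by (simp add: eq_1 le_divide_eq)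

lemma wall_slope_lower: "y \<le> 1 - 2 * \<delta> \<Longrightarrow> wall_slope \<delta> y = b ((y - \<delta>) / \<delta>) / \<delta>"
  unfolding wall_slope_def left_argument right_argument using \<delta> by (simp add: bump_eq_0 le_divide_eq)

lemma wall_slope_upper: "2 * \<delta> \<le> y \<Longrightarrow> wall_slope \<delta> y = - b ((1 - \<delta> - y) / \<delta>) / \<delta>"
  unfolding wall_slope_def left_argument right_argument using \<delta> by (simp add: bump_eq_0 le_divide_eq)

lemma lower_or_upper: "y \<le> 1 - 2 * \<delta> \<or> 2 * \<delta> \<le> y"
  using \<delta> by linarith

lemma wall_cut_bounds: "0 \<le> wall_cut \<delta> y" "wall_cut \<delta> y \<le> 1"
  using lower_or_upper[of y] by (auto simp: wall_cut_lower wall_cut_upper nonneg le_1)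

lemma wall_cut_support: "wall_cut \<delta> y \<noteq> 0 \<Longrightarrow> \<delta> \<le> y \<and> y \<le> 1 - \<delta>"
proof (rule ccontr)
  assume "wall_cut \<delta> y \<noteq> 0" "\<not> (\<delta> \<le> y \<and> y \<le> 1 - \<delta>)"
  moreover have "wall_cut \<delta> y = 0" if "y < \<delta>"
    using \<delta> that by (subst wall_cut_lower) (auto intro!: eq_0 divide_nonpos_pos)
  moreover have "wall_cut \<delta> y = 0" if "1 - \<delta> < y"
    using \<delta> that by (subst wall_cut_upper) (auto intro!: eq_0 divide_nonpos_pos)
  ultimately show False by linarith
qed

lemma wall_cut_eq_1: "2 * \<delta> \<le> y \<Longrightarrow> y \<le> 1 - 2 * \<delta> \<Longrightarrow> wall_cut \<delta> y = 1"
  using \<delta> by (subst wall_cut_lower) (auto intro!: eq_1 simp: le_divide_eq)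

lemma abs_wall_slope_le: "\<bar>wall_slope \<delta> y\<bar> \<le> K / \<delta>"
  using lower_or_upper[of y] \<delta>
  by (auto simp: wall_slope_lower wall_slope_upper bump_nonneg bump_le divide_right_mono)

lemma wall_slope_eq_0: "2 * \<delta> \<le> y \<Longrightarrow> y \<le> 1 - 2 * \<delta> \<Longrightarrow> wall_slope \<delta> y = 0"
  using \<delta> by (subst wall_slope_lower) (auto intro!: bump_eq_0 simp: le_divide_eq)

text \<open>The slope lives within distance \<open>2 * \<delta>\<close> of a wall, where one of the
  two exponentials is at least \<open>exp (- 2)\<close>. This is the origin of \<open>exp 2\<close>
  in the constants.\<close>

lemma abs_wall_slope_le_weight: "\<bar>wall_slope \<delta> y\<bar> \<le> K * exp 2 / \<delta> * wall_weight \<delta> y"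
proof (cases "wall_slope \<delta> y = 0")
  case True
  then show ?thesis using K_nonneg \<delta> wall_weight_pos[of \<delta> y] by simp
next
  case False
  then have "y \<le> 2 * \<delta> \<or> 1 - y \<le> 2 * \<delta>" using wall_slope_eq_0[of y] by linarith
  then have "- 2 \<le> - y / \<delta> \<or> - 2 \<le> - (1 - y) / \<delta>" using \<delta> by (simp add: field_simps)
  then have "exp (- 2) \<le> wall_weight \<delta> y"
    unfolding wall_weight_def
    by (metis add_increasing add_increasing2 exp_ge_zero exp_le_cancel_iff)
  then have "1 \<le> exp 2 * wall_weight \<delta> y"
    using mult_left_mono[of "exp (- 2)" "wall_weight \<delta> y" "exp 2"] by (simp flip: exp_add)
  from mult_left_mono[OF this, of "K / \<delta>"] show ?thesis
    using abs_wall_slope_le[of y] K_nonneg \<delta> by simp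
qed

end


section \<open>Shear fields as test fields in the weak formulation\<close>

definition shear_test :: "'n::finite \<Rightarrow> 'n \<Rightarrow> real \<Rightarrow> real \<Rightarrow> real \<Rightarrow> real \<times> (real^'n) \<Rightarrow> real^'n" where
  "shear_test w k T \<epsilon> \<delta> = (\<lambda>z. time_cut T \<epsilon> (fst z) *\<^sub>R (wall_cut \<delta> (snd z $ w) *\<^sub>R axis k 1))"

lemma smooth_shear_test:
  fixes w k :: "'n::finite"
  shows "smooth (shear_test w k T \<epsilon> \<delta>)"
proof -
  have "smooth (\<lambda>z :: real \<times> (real^'n). time_cut T \<epsilon> (fst z + 0))"
    by (rule smooth_affine[OF smooth_time_cut bounded_linear_fst])
  moreover have "smooth (\<lambda>z :: real \<times> (real^'n). wall_cut \<delta> (snd z $ w + 0))"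
    by (rule smooth_affine[OF smooth_wall_cut
          bounded_linear_compose[OF bounded_linear_vec_nth bounded_linear_snd]])
  ultimately show ?thesis
    unfolding shear_test_def by (intro smooth_scaleR smooth_const) simp_all
qed

lemma shear_test_space_derivative:
  fixes x :: "real^'n"
  shows "((\<lambda>y. shear_test w k T \<epsilon> \<delta> (t, y)) has_derivative
    (\<lambda>v. (time_cut T \<epsilon> t * (wall_slope \<delta> (x $ w) * v $ w)) *\<^sub>R axis k 1)) (at x)"
proof -
  have "((\<lambda>y :: real^'n. y $ w) has_derivative (\<lambda>v. v $ w)) (at x)"
    by (intro bounded_linear_imp_has_derivative bounded_linear_vec_nth)
  from has_derivative_compose[OF this wall_cut_has_derivative[unfolded has_field_derivative_def]]
  have "((\<lambda>y. wall_cut \<delta> (y $ w)) has_derivative (\<lambda>v. wall_slope \<delta> (x $ w) * v $ w)) (at x)" .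
  from has_derivative_scaleR_right[OF has_derivative_scaleR_left[OF this, of "axis k 1"], of "time_cut T \<epsilon> t"]
  show ?thesis by (simp add: shear_test_def)
qed

text \<open>Restricting to the line through \<open>(t, x)\<close> in the time direction leaves a
  single variable; uniqueness of the derivative of the restriction then identifies the directional
  derivative.\<close>

lemma shear_test_time_derivative:
  fixes x :: "real^'n"
  shows "dir_deriv (1, 0) (shear_test w k T \<epsilon> \<delta>) (t, x)
    = - (time_bump T \<epsilon> t * wall_cut \<delta> (x $ w)) *\<^sub>R axis k 1"
proof -
  have D: "((\<lambda>s. s *\<^sub>R (1, 0 :: real^'n) + (t, x)) has_derivative (\<lambda>s. s *\<^sub>R (1, 0))) (at 0)"
    by (auto intro!: derivative_eq_intros)
  have "((\<lambda>s. shear_test w k T \<epsilon> \<delta> (s *\<^sub>R (1, 0) + (t, x))) has_derivative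
      (\<lambda>s. dir_deriv (s *\<^sub>R (1, 0)) (shear_test w k T \<epsilon> \<delta>) (t, x))) (at 0)"
    using has_derivative_compose[OF D, of "shear_test w k T \<epsilon> \<delta>"]
      smooth_has_derivative[OF smooth_shear_test, of w k T \<epsilon> \<delta> "(t, x)"] by simp
  moreover have "((\<lambda>s. shear_test w k T \<epsilon> \<delta> (s *\<^sub>R (1, 0) + (t, x))) has_derivative
      (\<lambda>s. (s * (- time_bump T \<epsilon> t)) *\<^sub>R (wall_cut \<delta> (x $ w) *\<^sub>R axis k 1))) (at 0)"
  proof -
    have "((\<lambda>s. s + t) has_derivative (\<lambda>s. s)) (at 0)"
      by (auto intro!: derivative_eq_intros)
    from has_derivative_compose[OF this, of "time_cut T \<epsilon>" "(*) (- time_bump T \<epsilon> t)"]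
    have "((\<lambda>s. time_cut T \<epsilon> (s + t)) has_derivative (\<lambda>s. - time_bump T \<epsilon> t * s)) (at 0)"
      using time_cut_has_derivative[of T \<epsilon> t] by (simp add: has_field_derivative_def)
    from has_derivative_scaleR_left[OF this, of "wall_cut \<delta> (x $ w) *\<^sub>R axis k 1"]
    show ?thesis by (simp add: shear_test_def mult.commute)
  qed
  ultimately have "(\<lambda>s. dir_deriv (s *\<^sub>R (1, 0)) (shear_test w k T \<epsilon> \<delta>) (t, x)) =
      (\<lambda>s. (s * (- time_bump T \<epsilon> t)) *\<^sub>R (wall_cut \<delta> (x $ w) *\<^sub>R axis k 1))"
    by (rule has_derivative_unique)
  from fun_cong[OF this, of 1] show ?thesis by simp
qed

lemma shear_test_jacobian:
  "jacobian (\<lambda>y. shear_test w k T \<epsilon> \<delta> (t, y)) (at x) $ i $ j =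
    (if i = k \<and> j = w then time_cut T \<epsilon> t * wall_slope \<delta> (x $ w) else 0)"
  unfolding jacobian_nth dir_deriv_eq[OF shear_test_space_derivative]
  by (simp add: axis_def)

text \<open>The Jacobian has at most one nonzero entry, in row \<open>k\<close> and column
  \<open>w\<close>. It is off the diagonal because \<open>k \<noteq> w\<close>, so the divergence
  vanishes.\<close>

lemma solenoidal_test_shear_test:
  assumes "0 < \<epsilon>" "0 < \<delta>" "\<delta> \<le> 1/4" "k \<noteq> w"
  shows "solenoidal_test w T (shear_test w k T \<epsilon> \<delta>)"
  unfolding solenoidal_test_def
proof (intro conjI allI)
  show "smooth (shear_test w k T \<epsilon> \<delta>)" by (rule smooth_shear_test)
  show "tangentially_periodic w (\<lambda>x. shear_test w k T \<epsilon> \<delta> (t, x))" for t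
    by (auto simp: tangentially_periodic_def shear_test_def axis_def)
  have "min \<epsilon> \<delta> > 0" using assms by simp
  moreover have "t \<le> T - min \<epsilon> \<delta> \<and> min \<epsilon> \<delta> \<le> x $ w \<and> x $ w \<le> 1 - min \<epsilon> \<delta>"
    if "shear_test w k T \<epsilon> \<delta> (t, x) \<noteq> 0" for t x
  proof -
    have "time_cut T \<epsilon> t \<noteq> 0" "wall_cut \<delta> (x $ w) \<noteq> 0" using that by (auto simp: shear_test_def)
    then have "\<not> T - \<epsilon> \<le> t" "\<delta> \<le> x $ w \<and> x $ w \<le> 1 - \<delta>"
      using time_cut_eq_0[OF assms(1)] wall_cut_support[OF assms(2,3)] by blast+
    then show ?thesis by linarith
  qed
  ultimately show "\<exists>\<epsilon>'>0. \<forall>t x. shear_test w k T \<epsilon> \<delta> (t, x) \<noteq> 0 \<longrightarrow>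
      t \<le> T - \<epsilon>' \<and> \<epsilon>' \<le> x $ w \<and> x $ w \<le> 1 - \<epsilon>'" by blast
  show "trace (jacobian (\<lambda>y. shear_test w k T \<epsilon> \<delta> (t, y)) (at x)) = 0" for t x
    unfolding trace_def shear_test_jacobian using assms(4) by (intro sum.neutral) auto
qed

text \<open>With one Jacobian entry left, convection reduces to the flux
  \<open>u $ k * u $ w\<close> of momentum through the layers, and viscosity to the wall-normal
  derivative of component \<open>k\<close>.\<close>

lemma shear_test_weak_integrand:
  fixes u :: "real^'n" and M :: "real^'n^'n"
  shows "u \<bullet> dir_deriv (1, 0) (shear_test w k T \<epsilon> \<delta>) (t, x)
      + u \<bullet> (jacobian (\<lambda>y. shear_test w k T \<epsilon> \<delta> (t, y)) (at x) *v u)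
      - \<nu> * (M \<bullet> jacobian (\<lambda>y. shear_test w k T \<epsilon> \<delta> (t, y)) (at x))
    = time_cut T \<epsilon> t * wall_slope \<delta> (x $ w) * (u $ k * u $ w)
      - \<nu> * (time_cut T \<epsilon> t * wall_slope \<delta> (x $ w) * M $ k $ w)
      - time_bump T \<epsilon> t * (wall_cut \<delta> (x $ w) * u $ k)"
proof -
  define J where "J = jacobian (\<lambda>y. shear_test w k T \<epsilon> \<delta> (t, y)) (at x)"
  let ?c = "time_cut T \<epsilon> t * wall_slope \<delta> (x $ w)"
  have J: "J $ i $ j = (if i = k then if j = w then ?c else 0 else 0)" for i j
    unfolding J_def shear_test_jacobian by simp
  have "(J *v u) $ i = (if i = k then ?c * u $ w else 0)" for i
    unfolding matrix_vector_mult_def by (simp add: J if_distrib[of "\<lambda>y. y * _"] sum.delta cong: if_cong)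
  then have "u $ i \<bullet> (J *v u) $ i = (if i = k then ?c * (u $ k * u $ w) else 0)" for i
    by simp
  then have "u \<bullet> (J *v u) = ?c * (u $ k * u $ w)"
    by (simp add: inner_vec_def[of u] sum.delta)
  moreover have "M \<bullet> J = ?c * M $ k $ w"
  proof -
    have "M $ i \<bullet> J $ i = (if i = k then ?c * M $ k $ w else 0)" for i
      by (cases "i = k")
        (simp_all add: inner_vec_def J if_distrib[of "\<lambda>y. _ * y"] sum.delta mult_ac cong: if_cong)
    then show ?thesis by (simp add: inner_vec_def[of M] sum.delta)
  qed
  moreover have "u \<bullet> dir_deriv (1, 0) (shear_test w k T \<epsilon> \<delta>) (t, x) = - (time_bump T \<epsilon> t * (wall_cut \<delta> (x $ w) * u $ k))"
    by (simp add: shear_test_time_derivative inner_axis)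
  ultimately show ?thesis by (simp add: J_def)
qed

section \<open>Layer integrals over the space-time cylinder\<close>

lemma L2_on_cylinder_const:
  fixes T :: real
  assumes "0 < T"
  shows "L2_on ({0<..<T} \<times> (cell :: (real^'n) set)) (\<lambda>z. c :: 'b::euclidean_space)"
proof -
  let ?Q = "{0<..<T} \<times> (cell :: (real^'n) set)"
  have "emeasure lborel ?Q = ennreal T"
    using assms
    by (subst lborel_prod[symmetric], subst lborel.emeasure_pair_measure_Times)
      (auto simp: emeasure_cell)
  moreover have "?Q \<in> sets borel"
    by (intro borel_open open_Times) (simp_all add: cell_eq_box open_box)
  ultimately show ?thesis
    by (simp add: L2_on_def set_borel_measurable_def set_integrable_def)
qed

text \<open>The wall inequality holds at almost every time and is integrated in time. Its gain
  \<open>\<delta>\<^sup>2\<close> outweighs the factor \<open>1 / \<delta>\<close> that the slope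
  brings into the convective flux, so one power of \<open>\<delta>\<close> remains in front of the
  dissipation.\<close>

lemma wall_energy_le:
  fixes u :: "real \<Rightarrow> real^'n \<Rightarrow> real^'n"
  assumes "0 < \<delta>" and ws: "weak_solution w \<nu> T u G"
  shows "set_integrable lborel ({0<..<T} \<times> cell) (\<lambda>(t, x). wall_weight \<delta> (x $ w) * (norm (u t x))\<^sup>2)"
    and "(LINT z:{0<..<T} \<times> cell|lborel. case z of (t, x) \<Rightarrow> wall_weight \<delta> (x $ w) * (norm (u t x))\<^sup>2)
    \<le> 8 * \<delta>\<^sup>2 * (L2_norm ({0<..<T} \<times> cell) (\<lambda>(t, x). G t x))\<^sup>2"
proof -
  have U: "L2_on ({0<..<T} \<times> cell) (\<lambda>(t, x). u t x)" and G: "L2_on ({0<..<T} \<times> cell) (\<lambda>(t, x). G t x)"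
    and H10: "AE t in lborel. t \<in> {0<..<T} \<longrightarrow> H10 w (u t) (G t)"
    using ws by (auto simp: weak_solution_def)
  have m: "(\<lambda>z :: real \<times> (real^'n). wall_weight \<delta> (snd z $ w)) \<in> borel_measurable borel"
    by (intro borel_measurable_continuous_onI continuous_on_compose2[OF continuous_on_wall_weight]
        continuous_on_component continuous_on_snd continuous_on_id) auto
  have "set_integrable lborel ({0<..<T} \<times> cell)
      (\<lambda>z. wall_weight \<delta> (snd z $ w) * ((case z of (t, x) \<Rightarrow> u t x) \<bullet> (case z of (t, x) \<Rightarrow> u t x)))"
  proof (rule L2_mult_inner_integrable[OF U U m])
    show "\<bar>wall_weight \<delta> (snd z $ w)\<bar> \<le> 2" if "z \<in> {0<..<T} \<times> cell" for z :: "real \<times> (real^'n)"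
      using wall_weight_le[OF assms(1), of "snd z $ w"] wall_weight_pos[of \<delta> "snd z $ w"] that
      by (auto simp: cell_def less_imp_le)
  qed
  then show i: "set_integrable lborel ({0<..<T} \<times> cell) (\<lambda>(t, x). wall_weight \<delta> (x $ w) * (norm (u t x))\<^sup>2)"
    by (simp add: case_prod_beta' power2_norm_eq_inner)
  have "(LINT t:{0<..<T}|lborel. LINT x:cell|lborel. wall_weight \<delta> (x $ w) * (norm (u t x))\<^sup>2)
      \<le> (LINT t:{0<..<T}|lborel. 8 * \<delta>\<^sup>2 * (L2_norm cell (G t))\<^sup>2)"
  proof (rule set_integral_mono_AE)
    show "set_integrable lborel {0<..<T} (\<lambda>t. LINT x:cell|lborel. wall_weight \<delta> (x $ w) * (norm (u t x))\<^sup>2)"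
      using set_integral_Times(1)[OF i] by simp
    show "set_integrable lborel {0<..<T} (\<lambda>t. 8 * \<delta>\<^sup>2 * (L2_norm cell (G t))\<^sup>2)"
      by (intro set_integrable_mult_right L2_norm_Times(1) G)
    show "AE t\<in>{0<..<T} in lborel. (LINT x:cell|lborel. wall_weight \<delta> (x $ w) * (norm (u t x))\<^sup>2)
        \<le> 8 * \<delta>\<^sup>2 * (L2_norm cell (G t))\<^sup>2"
      using H10 by eventually_elim (use H10_wall_Poincare[OF _ assms(1)] in blast)
  qed
  then show "(LINT z:{0<..<T} \<times> cell|lborel. case z of (t, x) \<Rightarrow> wall_weight \<delta> (x $ w) * (norm (u t x))\<^sup>2)
    \<le> 8 * \<delta>\<^sup>2 * (L2_norm ({0<..<T} \<times> cell) (\<lambda>(t, x). G t x))\<^sup>2"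
    using set_integral_Times(2)[OF i] L2_norm_Times(2)[OF G] by simp
qed

text \<open>At each time the slope is at most \<open>K / \<delta>\<close> on layers of total measure
  \<open>4 * \<delta>\<close>, so its square integrates to order
  \<open>1 / \<delta>\<close>.\<close>

lemma wall_slope_integral_le:
  fixes w :: "'n::finite"
  assumes \<delta>: "0 < \<delta>" "\<delta> \<le> 1/4" and T: "0 < T"
  shows "set_integrable lborel ({0<..<T} \<times> cell) (\<lambda>z :: real \<times> (real^'n). (wall_slope \<delta> (snd z $ w))\<^sup>2)"
    and "(LINT z:{0<..<T} \<times> cell|lborel. (wall_slope \<delta> (snd (z :: real \<times> (real^'n)) $ w))\<^sup>2) \<le> 4 * T * K\<^sup>2 / \<delta>"
proof -
  have sq: "(wall_slope \<delta> y)\<^sup>2 \<le> (K / \<delta>)\<^sup>2" for y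
    using power_mono[OF abs_wall_slope_le[OF \<delta>] abs_ge_zero, of y 2] by simp
  have m: "(\<lambda>z :: real \<times> (real^'n). (wall_slope \<delta> (snd z $ w))\<^sup>2) \<in> borel_measurable borel"
    by (intro borel_measurable_continuous_onI continuous_intros continuous_on_compose2[OF continuous_on_wall_slope]
        continuous_on_component) auto
  show i: "set_integrable lborel ({0<..<T} \<times> cell) (\<lambda>z :: real \<times> (real^'n). (wall_slope \<delta> (snd z $ w))\<^sup>2)"
    using L2_mult_inner_integrable[OF L2_on_cylinder_const[OF T, of "1::real"] L2_on_cylinder_const[OF T, of 1] m,
        of "(K / \<delta>)\<^sup>2"] sq by simp
  have "(LINT z:{0<..<T} \<times> cell|lborel. (wall_slope \<delta> (snd (z :: real \<times> (real^'n)) $ w))\<^sup>2)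
      = (LINT t:{0<..<T}|lborel. LINT x:cell|lborel. (wall_slope \<delta> ((x :: real^'n) $ w))\<^sup>2)"
    using set_integral_Times(2)[OF i] by simp
  also have "\<dots> = T * (LINT x:cell|lborel. (wall_slope \<delta> ((x :: real^'n) $ w))\<^sup>2)"
    using T by (subst set_integral_const) auto
  also have "\<dots> \<le> T * (4 * \<delta> * (K / \<delta>)\<^sup>2)"
    using T \<delta> sq wall_slope_eq_0[OF \<delta>]
    by (intro mult_left_mono layer_integral_le continuous_intros continuous_on_wall_slope) auto
  also have "\<dots> = 4 * T * K\<^sup>2 / \<delta>" using \<delta> by (simp add: field_simps power2_eq_square)
  finally show "(LINT z:{0<..<T} \<times> cell|lborel. (wall_slope \<delta> (snd (z :: real \<times> (real^'n)) $ w))\<^sup>2) \<le> 4 * T * K\<^sup>2 / \<delta>" .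
qed

end

section \<open>Stability of the shear flow\<close>

lemma L2_norm_diff_const:
  fixes v :: "real^'n \<Rightarrow> real^'n"
  assumes v: "L2_on cell v"
  shows "(L2_norm cell (\<lambda>x. v x - A *\<^sub>R axis k 1))\<^sup>2
    = (L2_norm cell v)\<^sup>2 - 2 * A * (LINT x:cell|lborel. v x $ k) + A\<^sup>2"
proof -
  have c: "L2_on cell (\<lambda>x. axis k 1 :: real^'n)" by (intro L2_on_cell_continuous continuous_on_const)
  have i: "set_integrable lborel cell (\<lambda>x. v x $ k)"
    using L2_mult_inner_integrable[OF v c, of "\<lambda>_. 1" 1] by (simp add: inner_axis)
  have ic: "set_integrable lborel (cell :: (real^'n) set) (\<lambda>x. A\<^sup>2)"
    by (simp add: set_integrable_def emeasure_cell)
  have "(norm (v x - A *\<^sub>R axis k 1))\<^sup>2 = (norm (v x))\<^sup>2 - 2 * A * (v x $ k) + A\<^sup>2" for x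
    unfolding power2_norm_eq_inner
    by (simp add: inner_diff inner_commute[of "axis k 1"] inner_axis power2_eq_square algebra_simps)
  then have "(L2_norm cell (\<lambda>x. v x - A *\<^sub>R axis k 1))\<^sup>2
      = (LINT x:cell|lborel. (norm (v x))\<^sup>2 - 2 * A * (v x $ k) + A\<^sup>2)"
    by (simp only: L2_norm_power2)
  also have "\<dots> = (LINT x:cell|lborel. (norm (v x))\<^sup>2 - 2 * A * (v x $ k)) + A\<^sup>2"
    using ic i L2_on_integrable[OF v]
    by (subst set_integral_add(2)) (simp_all add: set_integral_const emeasure_cell measure_cell)
  also have "(LINT x:cell|lborel. (norm (v x))\<^sup>2 - 2 * A * (v x $ k))
      = (L2_norm cell v)\<^sup>2 - 2 * A * (LINT x:cell|lborel. v x $ k)"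
    using i L2_on_integrable[OF v] by (subst set_integral_diff(2)) (simp_all add: L2_norm_power2)
  finally show ?thesis .
qed

text \<open>Measuring \<open>v x $ k\<close> against \<open>A\<close> rather than 0 lets
  Cauchy-Schwarz produce the deviation itself. Young's inequality is weighted to give it the
  coefficient 1/2, so that at the final time half of it survives on the left.\<close>

lemma component_deviation_le:
  fixes v :: "real^'n \<Rightarrow> real^'n"
  assumes v: "L2_on cell v" and q: "continuous_on UNIV q" "(LINT x:cell|lborel. (q x)\<^sup>2) \<le> m" and A: "0 < A"
  shows "2 * A * \<bar>LINT x:cell|lborel. q x * (v x $ k - A)\<bar>
    \<le> (L2_norm cell (\<lambda>x. v x - A *\<^sub>R axis k 1))\<^sup>2 / 2 + 2 * A\<^sup>2 * m"
proof -
  let ?V = "L2_norm cell (\<lambda>x. v x - A *\<^sub>R axis k 1)"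
  have c: "L2_on cell (\<lambda>x. A *\<^sub>R axis k 1 :: real^'n)" by (intro L2_on_cell_continuous continuous_on_const)
  have d: "L2_on cell (\<lambda>x. v x - A *\<^sub>R axis k 1)" by (rule L2_on_diff[OF v c])
  have dk: "L2_on cell (\<lambda>x. (v x - A *\<^sub>R axis k 1) $ k)"
    by (rule L2_on_bounded_linear[OF d bounded_linear_vec_nth])
  have eq: "(v x - A *\<^sub>R axis k 1) $ k = v x $ k - A" for x by simp
  have le: "L2_norm cell (\<lambda>x. v x $ k - A) \<le> ?V"
    unfolding L2_norm_def
  proof (intro real_sqrt_le_mono set_integral_mono)
    show "set_integrable lborel cell (\<lambda>x. (norm (v x $ k - A))\<^sup>2)"
      using L2_on_integrable[OF dk] by simp
    show "(norm (v x $ k - A))\<^sup>2 \<le> (norm (v x - A *\<^sub>R axis k 1))\<^sup>2" for x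
      using component_le_norm_cart[of "v x - A *\<^sub>R axis k 1" k] by (intro power_mono) (simp_all add: eq)
  qed (rule L2_on_integrable[OF d])
  let ?q = "L2_norm cell q"
  have "\<bar>LINT x:cell|lborel. q x * (v x $ k - A)\<bar> \<le> ?q * L2_norm cell (\<lambda>x. v x $ k - A)"
    using L2_Cauchy_Schwarz[OF L2_on_cell_continuous[OF q(1)] dk, of "\<lambda>_. 1" 1] by simp
  also have "\<dots> \<le> ?q * ?V" by (intro mult_left_mono le L2_norm_nonneg)
  finally have "2 * A * \<bar>LINT x:cell|lborel. q x * (v x $ k - A)\<bar> \<le> 2 * A * (?q * ?V)"
    using A by simp
  also have "\<dots> \<le> ?V\<^sup>2 / 2 + 2 * A\<^sup>2 * ?q\<^sup>2"
    using zero_le_power2[of "?V - 2 * A * ?q"] by (simp add: power2_eq_square algebra_simps)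
  also have "\<dots> \<le> ?V\<^sup>2 / 2 + 2 * A\<^sup>2 * m"
    using q(2) by (simp add: L2_norm_power2 mult_left_mono)
  finally show ?thesis .
qed

context smooth_step
begin

text \<open>\<open>c\<close> stands for the value of the time cut-off. The convective product is put
  into the form to which the wall inequality applies; the viscous product is split so that it uses
  \<open>\<nu> / 2\<close> of the dissipation, a quarter of what the energy inequality
  supplies.\<close>

lemma momentum_flux_le:
  fixes u :: "real^'n" and M :: "real^'n^'n"
  assumes \<delta>: "0 < \<delta>" "\<delta> \<le> 1/4" and A: "0 < A" and \<nu>: "0 < \<nu>" and c: "0 \<le> c" "c \<le> 1"
  shows "2 * A * (\<nu> * (c * wall_slope \<delta> y * M $ k $ w) - c * wall_slope \<delta> y * (u $ k * u $ w))
    \<le> 2 * A * K * exp 2 / \<delta> * (wall_weight \<delta> y * (norm u)\<^sup>2) + \<nu> / 2 * (norm M)\<^sup>2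
      + 2 * \<nu> * A\<^sup>2 * (wall_slope \<delta> y)\<^sup>2"
proof -
  let ?s = "\<bar>wall_slope \<delta> y\<bar>"
  have "norm (M $ k $ w) \<le> norm M"
    using component_le_norm_cart[of "M $ k" w] Finite_Cartesian_Product.norm_nth_le[of M k] by simp
  then have "\<bar>c * wall_slope \<delta> y * M $ k $ w\<bar> \<le> 1 * ?s * norm M"
    unfolding abs_mult using c by (intro mult_mono) auto
  then have "2 * A * (\<nu> * (c * wall_slope \<delta> y * M $ k $ w)) \<le> 2 * A * (\<nu> * (?s * norm M))"
    using A \<nu> by (intro mult_left_mono) (auto simp: abs_le_iff)
  also have "\<dots> \<le> \<nu> * (1 / 2 * (norm M)\<^sup>2 + 2 * A\<^sup>2 * ?s\<^sup>2)"
  proof -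
    have "2 * A * (?s * norm M) \<le> 1 / 2 * (norm M)\<^sup>2 + 2 * A\<^sup>2 * ?s\<^sup>2"
      using zero_le_power2[of "norm M - 2 * A * ?s"] by (simp only: power2_eq_square) (simp add: algebra_simps)
    from mult_left_mono[OF this, of \<nu>] show ?thesis using \<nu> by (simp add: mult_ac)
  qed
  finally have visc: "2 * A * (\<nu> * (c * wall_slope \<delta> y * M $ k $ w))
      \<le> \<nu> / 2 * (norm M)\<^sup>2 + 2 * \<nu> * A\<^sup>2 * (wall_slope \<delta> y)\<^sup>2"
    by (simp add: algebra_simps)
  have "\<bar>c * wall_slope \<delta> y * (u $ k * u $ w)\<bar> \<le> 1 * (K * exp 2 / \<delta> * wall_weight \<delta> y) * (norm u * norm u)"
    unfolding abs_mult using c abs_wall_slope_le_weight[OF \<delta>, of y]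
    by (intro mult_mono component_le_norm_cart mult_nonneg_nonneg)
      (use K_nonneg \<delta> wall_weight_pos[of \<delta> y] in auto)
  then have "2 * A * (- (c * wall_slope \<delta> y * (u $ k * u $ w)))
      \<le> 2 * A * (K * exp 2 / \<delta> * wall_weight \<delta> y * (norm u)\<^sup>2)"
    using A by (intro mult_left_mono) (auto simp: abs_le_iff power2_eq_square)
  with visc show ?thesis by (simp add: algebra_simps)
qed

text \<open>In the weak formulation tested with \<open>shear_test\<close>, the time derivative
  yields the average of \<open>M\<close> near \<open>T\<close> with a minus sign and the initial
  term yields \<open>M 0\<close>. What remains are the two fluxes through the layers.\<close>

lemma momentum_at_cut:
  fixes u :: "real \<Rightarrow> real^'n \<Rightarrow> real^'n"
  assumes ws: "weak_solution w \<nu> T u G" and T: "0 < T" and \<nu>: "0 < \<nu>" and A: "0 < A" and kw: "k \<noteq> w"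
    and \<delta>: "0 < \<delta>" "\<delta> \<le> 1/4" and \<epsilon>: "0 < \<epsilon>" "2 * \<epsilon> \<le> T"
  defines "M \<equiv> \<lambda>t. LINT x:cell|lborel. wall_cut \<delta> (x $ w) * u t x $ k"
    and "N \<equiv> L2_norm ({0<..<T} \<times> cell) (\<lambda>(t, x). G t x)"
  shows "2 * A * (M 0 - (LINT t:{0<..<T}|lborel. time_bump T \<epsilon> t * M t))
    \<le> (16 * A * K * exp 2 * \<delta> + \<nu> / 2) * N\<^sup>2 + 8 * \<nu> * A\<^sup>2 * T * K\<^sup>2 / \<delta>"
proof -
  let ?I = "{0<..<T}" and ?Q = "{0<..<T} \<times> (cell :: (real^'n) set)"
  let ?c = "\<lambda>z :: real \<times> (real^'n). time_cut T \<epsilon> (fst z) * wall_slope \<delta> (snd z $ w)"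
  have U: "L2_on ?Q (\<lambda>z. u (fst z) (snd z))" and G: "L2_on ?Q (\<lambda>z. G (fst z) (snd z))"
    using ws by (auto simp: weak_solution_def case_prod_beta')
  have Ui: "L2_on ?Q (\<lambda>z. u (fst z) (snd z) $ i)" for i
    by (rule L2_on_bounded_linear[OF U bounded_linear_vec_nth])
  have Gi: "L2_on ?Q (\<lambda>z. G (fst z) (snd z) $ k $ w)"
    using L2_on_bounded_linear[OF L2_on_bounded_linear[OF G bounded_linear_vec_nth] bounded_linear_vec_nth] .
  have one: "L2_on ?Q (\<lambda>z. 1 :: real)" by (rule L2_on_cylinder_const[OF T])
  have cw: "continuous_on UNIV (\<lambda>z :: real \<times> (real^'n). snd z $ w)"
    by (intro continuous_on_component continuous_on_snd continuous_on_id)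
  have mc: "?c \<in> borel_measurable borel"
    by (intro borel_measurable_continuous_onI continuous_on_mult
        continuous_on_compose2[OF smooth_continuous[OF smooth_time_cut] continuous_on_fst]
        continuous_on_compose2[OF continuous_on_wall_slope cw] continuous_on_id) auto
  have bc: "\<bar>?c z\<bar> \<le> K / \<delta>" for z
  proof -
    have "\<bar>?c z\<bar> \<le> 1 * (K / \<delta>)"
      unfolding abs_mult using time_cut_bounds K_nonneg \<delta>
      by (intro mult_mono abs_wall_slope_le[OF \<delta>]) auto
    then show ?thesis by simp
  qed
  have mb: "(\<lambda>z :: real \<times> (real^'n). time_bump T \<epsilon> (fst z) * wall_cut \<delta> (snd z $ w)) \<in> borel_measurable borel"
    by (intro borel_measurable_continuous_onI continuous_on_mult
        continuous_on_compose2[OF continuous_on_time_bump continuous_on_fst]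
        continuous_on_compose2[OF smooth_continuous[OF smooth_wall_cut] cw] continuous_on_id) auto
  have bb: "\<bar>time_bump T \<epsilon> (fst z) * wall_cut \<delta> (snd z $ w)\<bar> \<le> K / \<epsilon>" for z :: "real \<times> (real^'n)"
  proof -
    have "\<bar>time_bump T \<epsilon> (fst z) * wall_cut \<delta> (snd z $ w)\<bar> \<le> K / \<epsilon> * 1"
      unfolding abs_mult using time_bump_nonneg[OF \<epsilon>(1)] time_bump_le[OF \<epsilon>(1)] wall_cut_bounds[OF \<delta>]
        K_nonneg \<epsilon> by (intro mult_mono) auto
    then show ?thesis by simp
  qed
  define F1 where "F1 = (\<lambda>z. ?c z * (u (fst z) (snd z) $ k * u (fst z) (snd z) $ w))"
  define F2 where "F2 = (\<lambda>z. ?c z * G (fst z) (snd z) $ k $ w)"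
  define F3 where "F3 = (\<lambda>z. time_bump T \<epsilon> (fst z) * (wall_cut \<delta> (snd z $ w) * u (fst z) (snd z) $ k))"
  have i1: "set_integrable lborel ?Q F1"
    using L2_mult_inner_integrable[OF Ui[of k] Ui[of w] mc bc] by (simp add: F1_def)
  have i2: "set_integrable lborel ?Q F2"
    using L2_mult_inner_integrable[OF Gi one mc bc] by (simp add: F2_def)
  have i3: "set_integrable lborel ?Q F3"
    using L2_mult_inner_integrable[OF Ui[of k] one mb bb] by (simp add: F3_def mult.assoc)
  have cut0: "time_cut T \<epsilon> 0 = 1" using \<epsilon> by (intro time_cut_eq_1) auto
  have f3: "(LINT z:?Q|lborel. F3 z) = (LINT t:?I|lborel. time_bump T \<epsilon> t * M t)"
    using set_integral_Times(2)[OF i3] by (simp add: F3_def M_def)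
  have "(LINT z:?Q|lborel. F1 z - \<nu> * F2 z - F3 z) + M 0 = 0"
  proof -
    have "(LINT z:?Q|lborel. case z of (t, x) \<Rightarrow>
            u t x \<bullet> dir_deriv (1, 0) (shear_test w k T \<epsilon> \<delta>) (t, x)
          + u t x \<bullet> (jacobian (\<lambda>y. shear_test w k T \<epsilon> \<delta> (t, y)) (at x) *v u t x)
          - \<nu> * (G t x \<bullet> jacobian (\<lambda>y. shear_test w k T \<epsilon> \<delta> (t, y)) (at x)))
        + (LINT x:cell|lborel. u 0 x \<bullet> shear_test w k T \<epsilon> \<delta> (0, x)) = 0"
      using ws solenoidal_test_shear_test[OF \<epsilon>(1) \<delta> kw] unfolding weak_solution_def by blast
    then show ?thesis
      unfolding shear_test_weak_integrand
      by (simp add: F1_def F2_def F3_def M_def case_prod_beta' shear_test_def cut0 inner_axis)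
  qed
  moreover have "(LINT z:?Q|lborel. F1 z - \<nu> * F2 z - F3 z) =
      (LINT z:?Q|lborel. F1 z - \<nu> * F2 z) - (LINT z:?Q|lborel. F3 z)"
    by (intro set_integral_diff(2) set_integral_diff(1) set_integrable_mult_right i1 i2 i3)
  ultimately have "M 0 - (LINT t:?I|lborel. time_bump T \<epsilon> t * M t) = - (LINT z:?Q|lborel. F1 z - \<nu> * F2 z)"
    using f3 by linarith
  moreover have "2 * A * (- (LINT z:?Q|lborel. F1 z - \<nu> * F2 z)) = (LINT z:?Q|lborel. 2 * A * (\<nu> * F2 z - F1 z))"
    using i1 i2 by (simp add: right_diff_distrib)
  ultimately have "2 * A * (M 0 - (LINT t:?I|lborel. time_bump T \<epsilon> t * M t)) = (LINT z:?Q|lborel. 2 * A * (\<nu> * F2 z - F1 z))"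
    by (simp only:)
  also have "\<dots> \<le> (LINT z:?Q|lborel. 2 * A * K * exp 2 / \<delta> * (wall_weight \<delta> (snd z $ w) * (norm (u (fst z) (snd z)))\<^sup>2)
        + \<nu> / 2 * (norm (G (fst z) (snd z)))\<^sup>2 + 2 * \<nu> * A\<^sup>2 * (wall_slope \<delta> (snd z $ w))\<^sup>2)"
    (is "_ \<le> (LINT z:?Q|lborel. ?a * ?W z + ?g * ?D z + ?s * ?S z)")
  proof (rule set_integral_mono)
    show "set_integrable lborel ?Q (\<lambda>z. 2 * A * (\<nu> * F2 z - F1 z))"
      by (intro set_integrable_mult_right set_integral_diff(1) i1 i2)
    show "set_integrable lborel ?Q (\<lambda>z. ?a * ?W z + ?g * ?D z + ?s * ?S z)"
      using wall_energy_le(1)[OF \<delta>(1) ws]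
      by (intro set_integral_add(1) set_integrable_mult_right L2_on_integrable G wall_slope_integral_le(1) \<delta> T)
        (simp add: case_prod_beta')
    show "2 * A * (\<nu> * F2 z - F1 z) \<le> ?a * ?W z + ?g * ?D z + ?s * ?S z" for z
      unfolding F1_def F2_def using time_cut_bounds by (intro momentum_flux_le \<delta> A \<nu>)
  qed
  also have "\<dots> = ?a * (LINT z:?Q|lborel. ?W z) + ?g * N\<^sup>2 + ?s * (LINT z:?Q|lborel. ?S z)"
  proof -
    have iW: "set_integrable lborel ?Q (\<lambda>z. ?a * ?W z)"
      using wall_energy_le(1)[OF \<delta>(1) ws]
      by (intro set_integrable_mult_right) (simp add: case_prod_beta')
    have iD: "set_integrable lborel ?Q (\<lambda>z. ?g * ?D z)"
      by (intro set_integrable_mult_right L2_on_integrable G)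
    have iS: "set_integrable lborel ?Q (\<lambda>z. ?s * ?S z)"
      by (intro set_integrable_mult_right wall_slope_integral_le(1) \<delta> T)
    have N: "N\<^sup>2 = (LINT z:?Q|lborel. ?D z)"
      by (simp add: N_def L2_norm_power2 case_prod_beta')
    show ?thesis
      unfolding N set_integral_add(2)[OF set_integral_add(1)[OF iW iD] iS] set_integral_add(2)[OF iW iD]
      by (simp only: set_integral_mult_right)
  qed
  also have "\<dots> \<le> ?a * (8 * \<delta>\<^sup>2 * N\<^sup>2) + ?g * N\<^sup>2 + ?s * (4 * T * K\<^sup>2 / \<delta>)"
    using A \<nu> \<delta> K_nonneg wall_energy_le(2)[OF \<delta>(1) ws]
    by (intro add_mono mult_left_mono wall_slope_integral_le(2) T order_refl)
      (auto simp: case_prod_beta' N_def)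
  also have "\<dots> = (16 * A * K * exp 2 * \<delta> + \<nu> / 2) * N\<^sup>2 + 8 * \<nu> * A\<^sup>2 * T * K\<^sup>2 / \<delta>"
    using \<delta> by (simp add: field_simps power2_eq_square)
  finally show ?thesis .
qed

text \<open>The bound at the cut-off is uniform in \<open>\<epsilon>\<close>. Pairing
  \<open>u\<close> with the fixed field \<open>wall_cut \<delta> (x $ w) *\<^sub>R axis k 1\<close>
  makes \<open>M\<close> continuous by weak continuity, so its averages converge to
  \<open>M T\<close>.\<close>

lemma momentum_at_end:
  fixes u :: "real \<Rightarrow> real^'n \<Rightarrow> real^'n"
  assumes ws: "weak_solution w \<nu> T u G" and T: "0 < T" and \<nu>: "0 < \<nu>" and A: "0 < A" and kw: "k \<noteq> w"
    and \<delta>: "0 < \<delta>" "\<delta> \<le> 1/4"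
  defines "M \<equiv> \<lambda>t. LINT x:cell|lborel. wall_cut \<delta> (x $ w) * u t x $ k"
    and "N \<equiv> L2_norm ({0<..<T} \<times> cell) (\<lambda>(t, x). G t x)"
  shows "2 * A * (M 0 - M T) \<le> (16 * A * K * exp 2 * \<delta> + \<nu> / 2) * N\<^sup>2 + 8 * \<nu> * A\<^sup>2 * T * K\<^sup>2 / \<delta>"
proof -
  have "L2_on cell (\<lambda>x. wall_cut \<delta> (x $ w) *\<^sub>R axis k 1 :: real^'n)"
    by (intro L2_on_cell_continuous smooth_continuous smooth_scaleR smooth_wall smooth_wall_cut smooth_const)
  then have "continuous_on {0..T} (\<lambda>t. LINT x:cell|lborel. u t x \<bullet> (wall_cut \<delta> (x $ w) *\<^sub>R axis k 1))"
    using ws unfolding weak_solution_def weakly_continuous_def by blast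
  then have "continuous_on {0..T} M" by (simp add: M_def inner_axis)
  then have "(\<lambda>n. 2 * A * (M 0 - (LINT t:{0<..<T}|lborel. time_bump T (T / real (n + 2)) t * M t)))
      \<longlonglongrightarrow> 2 * A * (M 0 - M T)"
    by (intro tendsto_intros time_average_tendsto T)
  then show ?thesis
  proof (rule LIMSEQ_le_const2, intro exI[of _ 0] allI impI)
    fix n :: nat
    show "2 * A * (M 0 - (LINT t:{0<..<T}|lborel. time_bump T (T / real (n + 2)) t * M t))
        \<le> (16 * A * K * exp 2 * \<delta> + \<nu> / 2) * N\<^sup>2 + 8 * \<nu> * A\<^sup>2 * T * K\<^sup>2 / \<delta>"
      unfolding M_def N_def
      by (rule momentum_at_cut[OF ws T \<nu> A kw \<delta>]) (use T in \<open>simp_all add: field_simps\<close>)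
  qed
qed

lemma wall_layer_integral_le:
  fixes w :: "'n::finite"
  assumes "0 < \<delta>" "\<delta> \<le> 1/4"
  shows "(LINT x:cell|lborel. (1 - wall_cut \<delta> ((x :: real^'n) $ w))\<^sup>2) \<le> 4 * \<delta>"
proof -
  have "(LINT x:cell|lborel. (1 - wall_cut \<delta> ((x :: real^'n) $ w))\<^sup>2) \<le> 4 * \<delta> * 1"
    using wall_cut_bounds[OF assms] wall_cut_eq_1[OF assms]
    by (intro layer_integral_le assms continuous_intros smooth_continuous smooth_wall_cut)
      (auto intro!: power_le_one)
  then show ?thesis by simp
qed

text \<open>\<open>c\<close> is dictated by absorption: with \<open>\<delta> = c * \<nu> / A\<close>
  the convective coefficient \<open>16 * A * K * exp 2 * \<delta>\<close> is at most
  \<open>\<nu> / 2\<close>. The summand 1 next to \<open>K\<close> makes \<open>c\<close> positive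
  from \<open>0 \<le> K\<close> alone.\<close>

lemma shear_deviation_bound:
  fixes u :: "real \<Rightarrow> real^'n \<Rightarrow> real^'n" and k w :: 'n
  assumes lh: "leray_hopf w \<nu> T u G" and kw: "k \<noteq> w" and T: "0 < T" and \<nu>: "0 < \<nu>" and A: "0 < A"
  defines "c \<equiv> 1 / (32 * (K + 1) * exp 2)"
    and "E \<equiv> \<lambda>t. (L2_norm cell (\<lambda>x. u t x - A *\<^sub>R axis k 1))\<^sup>2"
    and "N \<equiv> L2_norm ({0<..<T} \<times> cell) (\<lambda>(t, x). G t x)"
  shows "E T + \<nu> * N\<^sup>2 \<le> 3 * E 0 + 16 * K\<^sup>2 / c * A^3 * T + 32 * c * \<nu> * A"
proof -
  have ws: "weak_solution w \<nu> T u G" using lh by (simp add: leray_hopf_def)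
  have c: "0 < c" using K_nonneg by (simp add: c_def)
  have ut: "L2_on cell (u t)" if "t \<in> {0..T}" for t
    using ws that unfolding weak_solution_def weakly_continuous_def by blast
  have u0: "L2_on cell (u 0)" and uT: "L2_on cell (u T)" using ut T by simp_all
  define P where "P t = (LINT x:cell|lborel. u t x $ k)" for t
  have energy: "E T + 2 * \<nu> * N\<^sup>2 \<le> E 0 + 2 * A * (P 0 - P T)"
    using energy_at_end[OF T lh] L2_norm_diff_const[OF u0, of A k] L2_norm_diff_const[OF uT, of A k]
    by (simp add: E_def N_def P_def algebra_simps)
  define \<delta> where "\<delta> = c * \<nu> / A"
  have \<delta>0: "0 < \<delta>" using c \<nu> A by (simp add: \<delta>_def)
  \<comment> \<open>\<open>q\<close> weighs the layers and \<open>1 - q\<close> the interior.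
    Subtracting \<open>A\<close> in the layers changes the momentum by the integral of
    \<open>A * q\<close>, which is constant in time and drops out of the difference. A general
    \<open>q\<close> serves both cases below.\<close>
  have split: "P 0 - P T = (D 0 - D T) + (Q 0 - Q T)"
    if cq: "continuous_on UNIV q" and Q: "\<And>t. Q t = (LINT x:cell|lborel. (1 - q x) * u t x $ k)"
      and D: "\<And>t. D t = (LINT x:cell|lborel. q x * (u t x $ k - A))"
    for q :: "real^'n \<Rightarrow> real" and Q D
  proof -
    have *: "P t = D t + Q t + (LINT x:cell|lborel. A * q x)" if t: "t \<in> {0..T}" for t
    proof -
      have uk: "L2_on cell (\<lambda>x. u t x $ k)" by (rule L2_on_bounded_linear[OF ut[OF t] bounded_linear_vec_nth])
      have one: "L2_on cell (\<lambda>x. 1 :: real)" and qL: "L2_on cell q"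
        by (intro L2_on_cell_continuous continuous_on_const cq)+
      have i: "set_integrable lborel cell (\<lambda>x. u t x $ k)" "set_integrable lborel cell (\<lambda>x. q x * u t x $ k)"
        "set_integrable lborel cell (\<lambda>x. A * q x)"
        using L2_mult_inner_integrable[OF uk one, of "\<lambda>_. 1" 1] L2_mult_inner_integrable[OF qL uk, of "\<lambda>_. 1" 1]
          L2_mult_inner_integrable[OF one qL, of "\<lambda>_. A" "\<bar>A\<bar>"] by simp_all
      have "D t = (LINT x:cell|lborel. q x * u t x $ k) - (LINT x:cell|lborel. A * q x)"
        unfolding D using set_integral_diff(2)[OF i(2,3)] by (simp add: right_diff_distrib mult.commute)
      moreover have "Q t = P t - (LINT x:cell|lborel. q x * u t x $ k)"
        unfolding Q P_def using set_integral_diff(2)[OF i(1,2)] by (simp add: left_diff_distrib)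
      ultimately show ?thesis by simp
    qed
    show ?thesis using *[of 0] *[of T] T by simp
  qed
  have "2 * A * (P 0 - P T) \<le> E 0 / 2 + E T / 2 + \<nu> * N\<^sup>2 + 8 * K\<^sup>2 / c * A^3 * T + 16 * c * \<nu> * A"
  proof (cases "\<delta> \<le> 1/4")
    case True
    define q where "q x = 1 - wall_cut \<delta> (x $ w)" for x :: "real^'n"
    define D where "D t = (LINT x:cell|lborel. q x * (u t x $ k - A))" for t
    define Q where "Q t = (LINT x:cell|lborel. wall_cut \<delta> (x $ w) * u t x $ k)" for t
    have cq: "continuous_on UNIV q"
      unfolding q_def by (intro continuous_intros smooth_continuous smooth_wall smooth_wall_cut)
    have m: "(LINT x:cell|lborel. (q x)\<^sup>2) \<le> 4 * \<delta>"
      unfolding q_def by (rule wall_layer_integral_le[OF \<delta>0 True])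
    have P: "P 0 - P T = (D 0 - D T) + (Q 0 - Q T)"
      by (rule split[OF cq]) (simp_all add: D_def Q_def q_def)
    have "2 * A * (P 0 - P T) = 2 * A * D 0 + 2 * A * (- D T) + 2 * A * (Q 0 - Q T)"
      unfolding P by (simp add: algebra_simps)
    also have "\<dots> \<le> 2 * A * \<bar>D 0\<bar> + 2 * A * \<bar>D T\<bar> + 2 * A * (Q 0 - Q T)"
      using A by (intro add_mono mult_left_mono) auto
    also have "\<dots> \<le> (E 0 / 2 + 2 * A\<^sup>2 * (4 * \<delta>)) + (E T / 2 + 2 * A\<^sup>2 * (4 * \<delta>))
        + ((16 * A * K * exp 2 * \<delta> + \<nu> / 2) * N\<^sup>2 + 8 * \<nu> * A\<^sup>2 * T * K\<^sup>2 / \<delta>)"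
      unfolding D_def E_def Q_def N_def
      by (intro add_mono component_deviation_le momentum_at_end[OF ws T \<nu> A kw \<delta>0 True] u0 uT cq m A)
    also have "\<dots> \<le> E 0 / 2 + E T / 2 + \<nu> * N\<^sup>2 + 8 * K\<^sup>2 / c * A^3 * T + 16 * c * \<nu> * A"
    proof -
      have "16 * A * K * exp 2 * \<delta> = \<nu> / 2 * (K / (K + 1))"
      proof -
        have "exp 2 * c = 1 / (32 * (K + 1))" by (simp add: c_def)
        moreover have "16 * A * K * exp 2 * \<delta> = 16 * K * \<nu> * (exp 2 * c)"
          using A by (simp add: \<delta>_def)
        ultimately have "16 * A * K * exp 2 * \<delta> = 16 * K * \<nu> * (1 / (32 * (K + 1)))"
          by (simp only:)
        also have "\<dots> = \<nu> / 2 * (K / (K + 1))" using K_nonneg by (simp add: field_simps)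
        finally show ?thesis .
      qed
      also have "\<dots> \<le> \<nu> / 2 * 1" using \<nu> K_nonneg by (intro mult_left_mono) auto
      finally have "(16 * A * K * exp 2 * \<delta> + \<nu> / 2) * N\<^sup>2 \<le> \<nu> * N\<^sup>2"
        by (intro mult_right_mono) auto
      moreover have "8 * \<nu> * A\<^sup>2 * T * K\<^sup>2 / \<delta> = 8 * K\<^sup>2 / c * A^3 * T"
        using A \<nu> c by (simp add: \<delta>_def field_simps power2_eq_square power3_eq_cube)
      moreover have "A\<^sup>2 * \<delta> = c * \<nu> * A" using A by (simp add: \<delta>_def power2_eq_square)
      ultimately show ?thesis by (simp add: algebra_simps)
    qed
    finally show ?thesis .
  next
    case False
    \<comment> \<open>With \<open>q = 1\<close> the whole channel counts as layer: the interior part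
      is zero and the layer has measure 1.\<close>
    define D where "D t = (LINT x:cell|lborel. 1 * (u t x $ k - A))" for t
    have P: "P 0 - P T = (D 0 - D T) + (0 - 0)"
      by (rule split[of "\<lambda>_. 1"]) (simp_all add: D_def)
    have "2 * A * (P 0 - P T) = 2 * A * D 0 + 2 * A * (- D T)"
      unfolding P by (simp add: algebra_simps)
    also have "\<dots> \<le> 2 * A * \<bar>D 0\<bar> + 2 * A * \<bar>D T\<bar>"
      using A by (intro add_mono mult_left_mono) auto
    also have "\<dots> \<le> (E 0 / 2 + 2 * A\<^sup>2 * 1) + (E T / 2 + 2 * A\<^sup>2 * 1)"
      unfolding D_def E_def
      by (intro add_mono component_deviation_le u0 uT continuous_on_const A)
        (simp_all add: set_integral_const emeasure_cell measure_cell)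
    also have "\<dots> \<le> E 0 / 2 + E T / 2 + \<nu> * N\<^sup>2 + 8 * K\<^sup>2 / c * A^3 * T + 16 * c * \<nu> * A"
    proof -
      \<comment> \<open>The two deviations cost \<open>4 * A\<^sup>2\<close>; a wide layer means
        small \<open>A\<close>, which turns this into the same term
        \<open>16 * c * \<nu> * A\<close> as in the other case.\<close>
      have "A < 4 * (c * \<nu>)" using False A by (simp add: \<delta>_def field_simps)
      then have "A * A \<le> A * (4 * (c * \<nu>))" using A by (intro mult_left_mono) auto
      then have "4 * A\<^sup>2 \<le> 16 * c * \<nu> * A" by (simp add: power2_eq_square algebra_simps)
      moreover have "0 \<le> \<nu> * N\<^sup>2" "0 \<le> 8 * K\<^sup>2 / c * A^3 * T" using \<nu> c A T by auto
      ultimately show ?thesis by linarith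
    qed
    finally show ?thesis .
  qed
  \<comment> \<open>\<open>E T / 2\<close> is taken from \<open>E T\<close>, and
    \<open>\<nu> * N\<^sup>2\<close> from \<open>2 * \<nu> * N\<^sup>2\<close>. Doubling the rest
    gives the coefficient 3 of \<open>E 0\<close> and again \<open>2 * \<nu> * N\<^sup>2\<close>, of
    which half is kept.\<close>
  then have "E T / 2 + \<nu> * N\<^sup>2 \<le> 3 / 2 * E 0 + 8 * K\<^sup>2 / c * A^3 * T + 16 * c * \<nu> * A"
    using energy by linarith
  moreover have "16 * K\<^sup>2 / c * A^3 * T = 2 * (8 * K\<^sup>2 / c * A^3 * T)" "0 \<le> \<nu> * N\<^sup>2"
    using \<nu> by simp_all
  ultimately show ?thesis by linarith
qed

end

text \<open>Both dimensions are instances, since the argument sees only a shear direction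
  \<open>k\<close> and a wall-normal direction \<open>w\<close>. The constant is a function of
  \<open>K\<close>, hence of the step profile.\<close>

lemma shear_flow_stability:
  fixes k w :: "'n::finite"
  assumes kw: "k \<noteq> w"
  shows "\<exists>C>0. \<forall>A \<nu> T (u :: real \<Rightarrow> real^'n \<Rightarrow> real^'n) G.
       0 < A \<longrightarrow> 0 < \<nu> \<longrightarrow> 0 < T \<longrightarrow> leray_hopf w \<nu> T u G \<longrightarrow>
       (let ubar = A *\<^sub>R axis k 1; Re = A / \<nu> in
         (L2_norm cell (\<lambda>x. u T x - ubar))\<^sup>2
           + \<nu> / 2 * (L2_norm ({0<..<T} \<times> cell) (\<lambda>(t, x). G t x))\<^sup>2
         \<le> 4 * (L2_norm cell (\<lambda>x. u 0 x - ubar))\<^sup>2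
           + C * A^3 * T + C * A\<^sup>2 * inverse Re * ln (2 + Re))"
proof -
  obtain H b K where "smooth_step H b K" using smooth_step_exists by blast
  then interpret smooth_step H b K .
  define c where "c = 1 / (32 * (K + 1) * exp 2)"
  \<comment> \<open>The first summand is the coefficient of \<open>A^3 * T\<close>. The second is
    twice \<open>32 * c\<close>, to compensate for the lower bound 1/2 used for
    \<open>ln (2 + A / \<nu>)\<close>.\<close>
  define C where "C = 16 * K\<^sup>2 / c + 64 * c"
  have c: "0 < c" using K_nonneg by (simp add: c_def)
  have C: "0 < C" using c by (simp add: C_def add_nonneg_pos)
  show ?thesis
    unfolding Let_def
  proof (intro exI[of _ C] conjI C allI impI)
    fix A \<nu> T :: real and u :: "real \<Rightarrow> real^'n \<Rightarrow> real^'n" and G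
    assume A: "0 < A" and \<nu>: "0 < \<nu>" and T: "0 < T" and lh: "leray_hopf w \<nu> T u G"
    let ?E = "\<lambda>t. (L2_norm cell (\<lambda>x. u t x - A *\<^sub>R axis k 1))\<^sup>2"
    let ?N = "(L2_norm ({0<..<T} \<times> cell) (\<lambda>(t, x). G t x))\<^sup>2"
    have "?E T + \<nu> * ?N \<le> 3 * ?E 0 + 16 * K\<^sup>2 / c * A^3 * T + 32 * c * \<nu> * A"
      unfolding c_def by (rule shear_deviation_bound[OF lh kw T \<nu> A])
    moreover have "0 \<le> \<nu> * ?N" "0 \<le> ?E 0" using \<nu> by auto
    moreover have "16 * K\<^sup>2 / c * (A^3 * T) \<le> C * (A^3 * T)"
      using c A T by (intro mult_right_mono) (auto simp: C_def)
    moreover have "32 * c * (\<nu> * A) \<le> C * A\<^sup>2 * inverse (A / \<nu>) * ln (2 + A / \<nu>)"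
    proof -
      have "1 / 2 \<le> ln (2::real)" using ln2_ge_two_thirds by simp
      also have "\<dots> \<le> ln (2 + A / \<nu>)"
        using divide_pos_pos[OF A \<nu>] by (subst ln_le_cancel_iff) simp_all
      finally have "1 / 2 \<le> ln (2 + A / \<nu>)" .
      then have "64 * c * (1 / 2) \<le> C * ln (2 + A / \<nu>)"
        using c C by (intro mult_mono) (auto simp: C_def)
      then have "\<nu> * A * (64 * c * (1 / 2)) \<le> \<nu> * A * (C * ln (2 + A / \<nu>))"
        using A \<nu> by (intro mult_left_mono) auto
      also have "\<dots> = C * A\<^sup>2 * inverse (A / \<nu>) * ln (2 + A / \<nu>)"
        using A \<nu> by (simp add: power2_eq_square)
      finally show ?thesis by (simp add: mult_ac)
    qed
    ultimately show "?E T + \<nu> / 2 * ?N \<le> 4 * ?E 0 + C * A^3 * T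
        + C * A\<^sup>2 * inverse (A / \<nu>) * ln (2 + A / \<nu>)"
      by (simp only: mult.assoc)
  qed
qed

theorem theorem1p2:
  shows
   "(\<exists>C>0. \<forall>A \<nu> T (u :: real \<Rightarrow> real^2 \<Rightarrow> real^2) G.
       0 < A \<longrightarrow> 0 < \<nu> \<longrightarrow> 0 < T \<longrightarrow> leray_hopf 2 \<nu> T u G \<longrightarrow>
       (let ubar = A *\<^sub>R axis 1 1; Re = A / \<nu> in
         (L2_norm cell (\<lambda>x. u T x - ubar))\<^sup>2
           + \<nu> / 2 * (L2_norm ({0<..<T} \<times> cell) (\<lambda>(t, x). G t x))\<^sup>2
         \<le> 4 * (L2_norm cell (\<lambda>x. u 0 x - ubar))\<^sup>2
           + C * A^3 * T + C * A\<^sup>2 * inverse Re * ln (2 + Re))) \<and>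
    (\<exists>C>0. \<forall>A \<nu> T (u :: real \<Rightarrow> real^3 \<Rightarrow> real^3) G.
       0 < A \<longrightarrow> 0 < \<nu> \<longrightarrow> 0 < T \<longrightarrow> leray_hopf 3 \<nu> T u G \<longrightarrow>
       (let ubar = A *\<^sub>R axis 1 1; Re = A / \<nu> in
         (L2_norm cell (\<lambda>x. u T x - ubar))\<^sup>2
           + \<nu> / 2 * (L2_norm ({0<..<T} \<times> cell) (\<lambda>(t, x). G t x))\<^sup>2
         \<le> 4 * (L2_norm cell (\<lambda>x. u 0 x - ubar))\<^sup>2
           + C * A^3 * T + C * A\<^sup>2 * inverse Re * ln (2 + Re)))"
  \<comment> \<open>The side conditions left over are \<open>1 \<noteq> 2\<close> and
    \<open>1 \<noteq> 3\<close> in the respective index types.\<close>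
  by (intro conjI shear_flow_stability) simp_all

end
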